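(* Let $\mu$ be the uniform probability measure on $\{-1,0,1\}$, let $a=2$, and let $c=\log 2/H(2,\mu)$. Then $c=1.01136\dots$, and the mixing time of $X_n\bmod q$ is $(c+o(1))\log_2q$ for almost all odd $q$ (and never less than this). That is, for all $\delta>0$ and $\eta>0$: (i) for all sufficiently large integers $q$ and all integers $n\ge 0$ with $n\le(c-\delta)\log_2q$, we have $\frac12\|\mu_n\bmod q-u_q\|\ge1-\eta$; (ii) the number of odd integers $q\le Q$ for which there exists an integer $n\ge(c+\delta)\log_2q$ with $\|\mu_n\bmod q-u_q\|>\eta$ is $o(Q)$ as $Q\to\infty$.
   Context: $X_0=0$ and $X_{n+1}=2X_n+b_n$ where the $b_n$ are i.i.d. of law $\mu$; $\mu_n$ is the law of $X_n$ on $\mathbf Z$, i.e. the law of $\sum_{i=0}^{n-1}b_i2^i$. The entropy of a finitely supported probability measure $\rho$ on $\mathbf Z$ is $H(\rho)=\sum_x\rho(\{x\})\log\rho(\{x\})^{-1}$ (natural logarithm), and the asymptotic entropy is $H(2,\mu)=\lim_{n\to\infty}\frac1nH(\mu_n)$ (the limit is well known to exist). $\mu_n\bmod q$ is the pushforward of $\mu_n$ to $\mathbf{Z}/q\mathbf{Z}$, $u_q$ is the uniform probability measure on $\mathbf{Z}/q\mathbf{Z}$, and $\|\cdot\|$ is the $l^1$ norm, $\|\rho\|=\sum_x|\rho(\{x\})|$. The numerical value $H(2,\mu)/\log2=0.9887658714\dots$ is a known result of Hare, Hare, Morris and Shen ("The entropy of Cantor-like measures", Acta Math. Hungar. 2019)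 and may be taken as given. *)

theory Defs
  imports "HOL-Probability.Probability" "HOL-Library.Landau_Symbols"
begin

primrec walk :: "int \<Rightarrow> (nat \<Rightarrow> int) \<Rightarrow> nat \<Rightarrow> int" where
  "walk a b 0 = 0"
| "walk a b (Suc n) = a * walk a b n + b n"

text \<open>The law of \<open>X_n\<close> depends only on \<open>b_0, \<dots>, b_(n-1)\<close>, which are drawn independently
  from \<open>\<mu>\<close>; the argument 0 of \<^const>\<open>Pi_pmf\<close> is the irrelevant default value outside \<open>{..<n}\<close>.\<close>

definition walk_law :: "int \<Rightarrow> int pmf \<Rightarrow> nat \<Rightarrow> int pmf" where
  "walk_law a \<mu> n = map_pmf (\<lambda>b. walk a b n) (Pi_pmf {..<n} 0 (\<lambda>_. \<mu>))"

text \<open>Only meaningful for finitely supported \<open>\<rho>\<close>.\<close>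

definition entropy_pmf :: "int pmf \<Rightarrow> real" where
  "entropy_pmf \<rho> = (\<Sum>x\<in>set_pmf \<rho>. pmf \<rho> x * ln (1 / pmf \<rho> x))"

definition asymptotic_entropy :: "int \<Rightarrow> int pmf \<Rightarrow> real" where
  "asymptotic_entropy a \<mu> = lim (\<lambda>n. entropy_pmf (walk_law a \<mu> n) / real n)"

text \<open>For \<open>q \<ge> 1\<close>, the ring of integers modulo \<open>q\<close> is represented by the residues \<open>{0..<q}\<close>;
  \<open>q = 0\<close> is a junk value.\<close>

definition residues_mod :: "nat \<Rightarrow> int set" where
  "residues_mod q = {0..<int q}"

definition mod_law :: "nat \<Rightarrow> int pmf \<Rightarrow> int pmf" where
  "mod_law q \<rho> = map_pmf (\<lambda>x. x mod int q) \<rho>"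

definition uniform_mod :: "nat \<Rightarrow> int pmf" where
  "uniform_mod q = pmf_of_set (residues_mod q)"

definition l1_norm_mod :: "nat \<Rightarrow> (int \<Rightarrow> real) \<Rightarrow> real" where
  "l1_norm_mod q f = (\<Sum>x\<in>residues_mod q. \<bar>f x\<bar>)"

text \<open>The \<open>l\<^sup>1\<close> distance \<open>\<parallel>\<mu>\<^sub>n mod q - u\<^sub>q\<parallel>\<close>, without the factor \<open>1/2\<close> of total variation.\<close>

definition walk_dist :: "int \<Rightarrow> int pmf \<Rightarrow> nat \<Rightarrow> nat \<Rightarrow> real" where
  "walk_dist a \<mu> q n =
     l1_norm_mod q (\<lambda>x. pmf (mod_law q (walk_law a \<mu> n)) x - pmf (uniform_mod q) x)"

end

theory Submission
  imports Defs "HOL-Computational_Algebra.Primes" "HOL-Real_Asymp.Real_Asymp"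
begin

text \<open>Let \<open>H\<close> be the asymptotic entropy, so that \<open>X_n\<close> behaves as if it were uniform on about \<open>exp (H n)\<close>
integers. Since \<open>c H = ln 2\<close>, this number reaches \<open>q\<close> at time \<open>c log_2 q\<close>.

Before that time the walk cannot be mixed: with probability close to 1, \<open>X_n\<close> is an atom of weight at
least \<open>exp (- h n)\<close> for a given \<open>h > H\<close> (\<open>light_atoms_rare\<close>), there are at most \<open>exp (h n)\<close> such atoms,
and \<open>exp (h n)\<close> is much smaller than \<open>q\<close> (\<open>not_mixed_early\<close>).

For the upper bound, consider the moduli up to \<open>Q\<close> and \<open>N\<close> steps, with \<open>N\<close> a little above
\<open>c log_2 Q\<close>, cut into \<open>T\<close> blocks of \<open>m\<close> digits. In each block discard the atoms of weight
above \<open>exp (- h m)\<close>, where now \<open>h < H\<close>. By a Chernoff bound the discarded mass is exponentially small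
in \<open>m\<close> (\<open>heavy_atoms_rare\<close>). Let \<open>\<rho>\<close> be the density formed by the truncated blocks. By Parseval and
Cauchy-Schwarz it is enough that the sum of \<open>|\<rho>^(x/q)|^2\<close> over \<open>0 < x < q\<close> is small
(\<open>walk_dist_le_fourier\<close>). Two facts about \<open>x/q\<close> control it.

\<^item> Each change between consecutive binary digits of \<open>x/q\<close> costs a factor \<open>1/3\<close> in the Fourier transform
of the walk (\<open>norm_fourier_law_le\<close>). If at least \<open>\<epsilon> N\<close> of the first \<open>N\<close> digit pairs change, some block
contributes an exponentially small factor, and this survives the truncation because the discarded mass is
itself exponentially small (\<open>fourier_block_gain\<close>). The remaining \<open>T - 1\<close> blocks still have a density of
at most about \<open>1/Q\<close>. Hence, on average over \<open>q\<close>, two samples of them collide modulo \<open>q\<close> with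
probability at most \<open>Q^(-1 + o(1))\<close>: an integer of size \<open>2^N\<close> has only \<open>Q^o(1)\<close> divisors
(\<open>sum_fourier_sq_le\<close>, \<open>divisor_bound\<close>). The factor \<open>Q^o(1)\<close> is then absorbed by the exponentially small one.

\<^item> For all but \<open>\<eta> Q\<close> of the moduli every \<open>x/q\<close> has at least \<open>\<epsilon> N\<close> changes, if \<open>\<epsilon>\<close> is small
(\<open>few_flips_rare\<close>). Here \<open>c > 1\<close> is used: in lowest terms let \<open>x/q = r/d\<close>; already
\<open>(1 + \<kappa>) log_2 d\<close> digits with few changes confine \<open>r/d\<close> to \<open>d^o(1)\<close> intervals of length \<open>d^(-1-\<kappa>)\<close>, which
contain only \<open>d^(1-\<kappa>+o(1))\<close> fractions with denominators of this size, and a denominator \<open>d\<close> affects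
at most \<open>Q/d\<close> moduli.

Later times need no argument of their own, since a further step never increases the distance when \<open>q\<close> is
odd (\<open>walk_dist_Suc_le\<close>).\<close>

section \<open>The law of the walk\<close>

abbreviation (input) steps :: "int pmf" where "steps \<equiv> pmf_of_set {-1, 0, 1}"

definition law :: "nat \<Rightarrow> int \<Rightarrow> real" where
  "law n = pmf (walk_law 2 steps n)"

definition window :: "nat \<Rightarrow> int set" where "window n = {- (2 ^ n) <..< 2 ^ n}"

lemma finite_window [simp]: "finite (window n)" by (simp add: window_def)

lemma mem_window: "x \<in> window n \<longleftrightarrow> \<bar>x\<bar> < 2 ^ n" by (auto simp: window_def)

lemma walk_cong: "(\<And>i. i < n \<Longrightarrow> b i = b' i) \<Longrightarrow> walk a b n = walk a b' n"
  by (induction n) auto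

lemma walk_law_0: "walk_law a \<mu> 0 = return_pmf 0"
  by (simp add: walk_law_def)

lemma walk_law_Suc:
  "walk_law a \<mu> (Suc n) = bind_pmf (walk_law a \<mu> n) (\<lambda>x. map_pmf (\<lambda>b. a * x + b) \<mu>)"
proof -
  have "walk a (f(n := y)) n = walk a f n" for f and y :: int
    by (rule walk_cong) auto
  then show ?thesis
    unfolding walk_law_def lessThan_Suc
    by (subst Pi_pmf_insert') (auto simp: map_bind_pmf bind_map_pmf map_pmf_def bind_assoc_pmf bind_return_pmf
        intro!: bind_pmf_cong, subst bind_commute_pmf, rule refl)
qed

lemma walk_law_add:
  "walk_law a \<mu> (n + m) = bind_pmf (walk_law a \<mu> n) (\<lambda>y. map_pmf (\<lambda>z. y * a ^ m + z) (walk_law a \<mu> m))"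
proof (induction m)
  case 0
  show ?case by (simp add: walk_law_0 bind_return_pmf')
next
  case (Suc m)
  have "walk_law a \<mu> (n + Suc m) = bind_pmf (walk_law a \<mu> (n + m)) (\<lambda>x. map_pmf (\<lambda>b. a * x + b) \<mu>)"
    by (simp add: walk_law_Suc)
  also have "\<dots> = bind_pmf (walk_law a \<mu> n) (\<lambda>y. map_pmf (\<lambda>z. y * a ^ Suc m + z) (walk_law a \<mu> (Suc m)))"
    unfolding Suc by (simp add: walk_law_Suc bind_assoc_pmf map_pmf_def bind_return_pmf algebra_simps)
  finally show ?case .
qed

lemma law_nonneg [simp]: "0 \<le> law n x"
  by (simp add: law_def)

lemma set_walk_law: "set_pmf (walk_law 2 steps n) \<subseteq> window n"
proof (induction n)
  case (Suc n)
  have "2 * x + b \<in> window (Suc n)" if "x \<in> window n" "b \<in> {-1, 0, 1}" for x b :: int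
    using that by (auto simp: window_def)
  then have "2 * x + b \<in> window (Suc n)" if "x \<in> set_pmf (walk_law 2 steps n)" "b \<in> set_pmf steps" for x b :: int
    using that Suc by (auto )
  then show ?case by (auto simp: walk_law_Suc simp del: set_pmf_of_set)
qed (auto simp: walk_law_0 window_def)

lemma law_outside: "x \<notin> window n \<Longrightarrow> law n x = 0"
  using set_walk_law[of n] by (auto simp: law_def set_pmf_iff)

lemma sum_law: "(\<Sum>x\<in>window n. law n x) = 1"
  unfolding law_def by (intro sum_pmf_eq_1 set_walk_law) simp

lemma law_le_1: "law n x \<le> 1"
  by (simp add: law_def pmf_le_1)

text \<open>The law of \<open>Y + 2^n Z\<close> for independent \<open>Y\<close> (density \<open>f\<close>) and \<open>Z\<close> (density \<open>g\<close>).\<close>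

definition join :: "nat \<Rightarrow> nat \<Rightarrow> (int \<Rightarrow> real) \<Rightarrow> (int \<Rightarrow> real) \<Rightarrow> int \<Rightarrow> real" where
  "join n m f g x = (\<Sum>z\<in>window m. g z * f (x - 2 ^ n * z))"

lemma law_add: "law (n + m) = join n m (law n) (law m)"
proof
  fix x
  have "law (m + n) x = measure_pmf.expectation (walk_law 2 steps m)
      (\<lambda>z. pmf (map_pmf (\<lambda>y. z * 2 ^ n + y) (walk_law 2 steps n)) x)"
    unfolding law_def walk_law_add by (simp add: pmf_bind)
  also have "\<dots> = (\<Sum>z\<in>window m. law m z * pmf (map_pmf (\<lambda>y. z * 2 ^ n + y) (walk_law 2 steps n)) x)"
    by (subst integral_measure_pmf[of "window m"]) (use set_walk_law in \<open>auto simp: law_def\<close>)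
  also have "\<dots> = join n m (law n) (law m) x"
  proof -
    have "pmf (map_pmf (\<lambda>y. z * 2 ^ n + y) (walk_law 2 steps n)) x = law n (x - 2 ^ n * z)" for z
    proof -
      have "pmf (map_pmf (\<lambda>y. z * 2 ^ n + y) (walk_law 2 steps n)) (z * 2 ^ n + (x - 2 ^ n * z))
          = pmf (walk_law 2 steps n) (x - 2 ^ n * z)"
        by (rule pmf_map_inj') (auto simp: inj_def)
      then show ?thesis by (simp add: law_def algebra_simps)
    qed
    then show ?thesis by (simp add: join_def)
  qed
  finally show "law (n + m) x = join n m (law n) (law m) x" by (simp add: add.commute)
qed

lemma join_window: "y \<in> window n \<Longrightarrow> z \<in> window m \<Longrightarrow> y + 2 ^ n * z \<in> window (n + m)"
proof -
  assume y: "y \<in> window n" and z: "z \<in> window m"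
  have "\<bar>y + 2 ^ n * z\<bar> \<le> \<bar>y\<bar> + 2 ^ n * \<bar>z\<bar>"
    using abs_triangle_ineq[of y "2 ^ n * z"] by (simp add: abs_mult)
  also have "\<dots> < 2 ^ n + 2 ^ n * \<bar>z\<bar>" using y by (simp add: mem_window)
  also have "\<dots> = 2 ^ n * (1 + \<bar>z\<bar>)" by (simp add: algebra_simps)
  also have "\<dots> \<le> 2 ^ n * 2 ^ m" using z by (intro mult_left_mono) (auto simp: mem_window)
  finally show ?thesis by (simp add: mem_window power_add)
qed

lemma join_outside:
  assumes f: "\<And>x. x \<notin> window n \<Longrightarrow> f x = 0" and x: "x \<notin> window (n + m)"
  shows "join n m f g x = 0"
proof -
  have "f (x - 2 ^ n * z) = 0" if "z \<in> window m" for z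
    using join_window[of "x - 2 ^ n * z" n z m] that x f by auto
  then show ?thesis by (simp add: join_def)
qed

lemma sum_join:
  fixes F :: "int \<Rightarrow> 'a :: real_algebra_1"
  assumes f: "\<And>x. x \<notin> window n \<Longrightarrow> f x = 0"
  shows "(\<Sum>x\<in>window (n + m). of_real (join n m f g x) * F x)
    = (\<Sum>z\<in>window m. \<Sum>y\<in>window n. of_real (g z) * of_real (f y) * F (y + 2 ^ n * z))"
proof -
  have *: "(\<Sum>x\<in>window (n + m). of_real (f (x - 2 ^ n * z)) * F x)
      = (\<Sum>y\<in>window n. of_real (f y) * F (y + 2 ^ n * z))" if z: "z \<in> window m" for z
  proof -
    have "(\<Sum>y\<in>window n. of_real (f y) * F (y + 2 ^ n * z))
      = (\<Sum>x\<in>(\<lambda>y. y + 2 ^ n * z) ` window n. of_real (f (x - 2 ^ n * z)) * F x)"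
      by (subst sum.reindex) (auto simp: inj_on_def)
    also have "\<dots> = (\<Sum>x\<in>window (n + m). of_real (f (x - 2 ^ n * z)) * F x)"
    proof (rule sum.mono_neutral_left)
      show "\<forall>x\<in>window (n + m) - (\<lambda>y. y + 2 ^ n * z) ` window n. of_real (f (x - 2 ^ n * z)) * F x = 0"
      proof
        fix x assume "x \<in> window (n + m) - (\<lambda>y. y + 2 ^ n * z) ` window n"
        then have "x - 2 ^ n * z \<notin> window n" by (auto simp: image_iff)
        then show "of_real (f (x - 2 ^ n * z)) * F x = 0" by (simp add: f)
      qed
    qed (use z join_window in auto)
    finally show ?thesis by simp
  qed
  have "(\<Sum>x\<in>window (n + m). of_real (join n m f g x) * F x)
    = (\<Sum>x\<in>window (n + m). \<Sum>z\<in>window m. of_real (g z) * (of_real (f (x - 2 ^ n * z)) * F x))"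
    by (simp add: join_def sum_distrib_right mult.assoc)
  also have "\<dots> = (\<Sum>z\<in>window m. \<Sum>x\<in>window (n + m). of_real (g z) * (of_real (f (x - 2 ^ n * z)) * F x))"
    by (rule sum.swap)
  also have "\<dots> = (\<Sum>z\<in>window m. \<Sum>y\<in>window n. of_real (g z) * of_real (f y) * F (y + 2 ^ n * z))"
    by (rule sum.cong[OF refl]) (simp add: sum_distrib_left[symmetric] * mult.assoc)
  finally show ?thesis .
qed

text \<open>The digits overlap only a little: \<open>x - 2^n z\<close> is in the window of \<open>n\<close> for just two values of \<open>z\<close>.
  This is what makes sup norms, power sums and entropies nearly multiplicative or additive along the digits.\<close>

lemma join_two_terms:
  assumes f: "\<And>x. x \<notin> window n \<Longrightarrow> f x = 0" and g: "\<And>x. x \<notin> window m \<Longrightarrow> g x = 0"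
  shows "join n m f g x = g (x div 2 ^ n) * f (x mod 2 ^ n)
    + g (x div 2 ^ n + 1) * f (x mod 2 ^ n - 2 ^ n)"
proof -
  let ?z = "x div 2 ^ n"
  have x: "x = 2 ^ n * ?z + x mod 2 ^ n" by simp
  have r: "0 \<le> x mod 2 ^ n" "x mod 2 ^ n < 2 ^ n" by simp_all
  have "join n m f g x = (\<Sum>z\<in>window m \<union> {?z, ?z + 1}. g z * f (x - 2 ^ n * z))"
    unfolding join_def by (rule sum.mono_neutral_left) (auto simp: g)
  also have "\<dots> = (\<Sum>z\<in>{?z, ?z + 1}. g z * f (x - 2 ^ n * z))"
  proof (rule sum.mono_neutral_right)
    show "\<forall>z\<in>window m \<union> {?z, ?z + 1} - {?z, ?z + 1}. g z * f (x - 2 ^ n * z) = 0"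
    proof
      fix z assume z: "z \<in> window m \<union> {?z, ?z + 1} - {?z, ?z + 1}"
      have "x - 2 ^ n * z \<notin> window n"
      proof
        assume "x - 2 ^ n * z \<in> window n"
        then have b: "- (2 ^ n) < x - 2 ^ n * z" "x - 2 ^ n * z < 2 ^ n" by (auto simp: window_def)
        have "2 ^ n * z < 2 ^ n * (?z + 2)" "2 ^ n * (?z - 1) < 2 ^ n * z"
          unfolding distrib_left right_diff_distrib using b r x by linarith+
        then have "z < ?z + 2" "?z - 1 < z" by simp_all
        then show False using z by auto
      qed
      then show "g z * f (x - 2 ^ n * z) = 0" by (simp add: f)
    qed
  qed auto
  also have "\<dots> = g ?z * f (x mod 2 ^ n) + g (?z + 1) * f (x mod 2 ^ n - 2 ^ n)"
    by (simp add: minus_mult_div_eq_mod[symmetric] algebra_simps)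
  finally show ?thesis .
qed

lemma join_le:
  assumes "\<And>x. x \<notin> window n \<Longrightarrow> f x = 0" "\<And>x. x \<notin> window m \<Longrightarrow> g x = 0"
    and "\<And>x. 0 \<le> f x" "\<And>x. 0 \<le> g x" "\<And>x. f x \<le> a" "\<And>x. g x \<le> b"
  shows "join n m f g x \<le> 2 * b * a"
proof -
  have "0 \<le> b" using assms(4)[of 0] assms(6)[of 0] by linarith
  then have "g y * f z \<le> b * a" for y z using assms by (intro mult_mono) auto
  from this[of "x div 2 ^ n" "x mod 2 ^ n"] this[of "x div 2 ^ n + 1" "x mod 2 ^ n - 2 ^ n"]
  show ?thesis by (subst join_two_terms) (use assms in auto)
qed

lemma join_nonneg: "(\<And>x. 0 \<le> f x) \<Longrightarrow> (\<And>x. 0 \<le> g x) \<Longrightarrow> 0 \<le> join n m f g x"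
  by (auto simp: join_def intro!: sum_nonneg)

lemma join_mono:
  "(\<And>x. 0 \<le> f x) \<Longrightarrow> (\<And>x. 0 \<le> g x) \<Longrightarrow> (\<And>x. f x \<le> f' x) \<Longrightarrow> (\<And>x. g x \<le> g' x) \<Longrightarrow>
    join n m f g x \<le> join n m f' g' x"
  unfolding join_def by (intro sum_mono mult_mono) (auto intro: order_trans[of 0 "g z" "g' z" for z])

lemma law_0: "law 0 x = (if x = 0 then 1 else 0)"
  by (simp add: law_def walk_law_0 indicator_def)

lemma window_1: "window 1 = {-1, 0, 1}" by (auto simp: window_def)

lemma law_1: "x \<in> window 1 \<Longrightarrow> law 1 x = 1 / 3"
proof -
  have "walk_law 2 steps 1 = steps"
    unfolding One_nat_def walk_law_Suc by (simp add: walk_law_0 bind_return_pmf map_pmf_idI)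
  moreover assume "x \<in> window 1"
  ultimately show ?thesis by (auto simp: law_def window_1[unfolded One_nat_def])
qed

lemma law_1_eq: "law 1 x = (if x \<in> {-1, 0, 1} then 1 / 3 else 0)"
  using law_1[of x] law_outside[of x 1] window_1 by auto

section \<open>Fractions whose binary digits rarely change\<close>

text \<open>The quotient modulo 4 consists of the binary digits \<open>j + 1\<close> and \<open>j + 2\<close> of \<open>x / q\<close>, and it is 1 or 2
  exactly if they differ.\<close>

definition flips :: "nat \<Rightarrow> nat \<Rightarrow> nat \<Rightarrow> nat" where
  "flips M x q = card {j. j < M \<and> (2 ^ (j + 2) * x div q) mod 4 \<in> {1, 2}}"

lemma flips_0 [simp]: "flips 0 x q = 0" by (simp add: flips_def)

lemma flips_Suc:
  "flips (Suc M) x q = flips M x q + (if (2 ^ (M + 2) * x div q) mod 4 \<in> {1, 2} then 1 else 0)"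
proof -
  have "{j. j < Suc M \<and> (2 ^ (j + 2) * x div q) mod 4 \<in> {1, 2}}
    = {j. j < M \<and> (2 ^ (j + 2) * x div q) mod 4 \<in> {1, 2}} \<union>
      (if (2 ^ (M + 2) * x div q) mod 4 \<in> {1, 2} then {M} else {})"
    by (auto simp: less_Suc_eq)
  then show ?thesis unfolding flips_def by (simp only:, subst card_Un_disjoint) auto
qed

lemma flips_add: "flips (M + M') x q = flips M x q + flips M' (2 ^ M * x) q"
  by (induction M') (simp_all add: flips_Suc power_add mult_ac)

lemma flips_mult_cancel: "c > 0 \<Longrightarrow> flips M (c * x) (c * q) = flips M x q"
  unfolding flips_def by (simp add: mult.left_commute[of _ c])

lemma flips_mod:
  assumes "q > 0" shows "flips M (x mod q) q = flips M x q"
proof -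
  have "2 ^ (j + 2) * x div q = 2 ^ (j + 2) * (x mod q) div q + 4 * (2 ^ j * (x div q))" for j
  proof -
    have "2 ^ (j + 2) * x = 2 ^ (j + 2) * (x mod q) + q * (4 * (2 ^ j * (x div q)))"
    proof -
      have "2 ^ (j + 2) * x = 2 ^ (j + 2) * (q * (x div q) + x mod q)" by simp
      then show ?thesis by (simp only: distrib_left power_add mult_ac add_ac) simp
    qed
    then show ?thesis using assms by simp
  qed
  then have "(2 ^ (j + 2) * x div q) mod 4 = (2 ^ (j + 2) * (x mod q) div q) mod 4" for j
    by (metis mod_mult_self2)
  then show ?thesis by (simp add: flips_def)
qed

lemma flips_blocks: "flips (M * K) x q = (\<Sum>j<K. flips M (2 ^ (M * j) * x) q)"
  proof (induction K)
  case (Suc K)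
  have "flips (M * K + M) x q = flips (M * K) x q + flips M (2 ^ (M * K) * x) q" by (rule flips_add)
  then show ?case using Suc by (simp add: add.commute)
qed simp

lemma flips_mono: "M \<le> M' \<Longrightarrow> flips M x q \<le> flips M' x q"
  using flips_add[of M "M' - M" x q] by simp

text \<open>As long as no digit changes, \<open>x / q\<close> is within \<open>1/4\<close> of an integer, and doubling it doubles the
  distance. This cannot happen \<open>i\<close> times in a row, as the distance is at least \<open>1 / q\<close> at the start.\<close>

lemma flips_pos:
  assumes x: "0 < x" "x < q" and q: "q < 2 ^ Suc i"
  shows "0 < flips i x q"
proof (rule ccontr)
  assume "\<not> 0 < flips i x q"
  then have no: "(2 ^ (j + 2) * x div q) mod 4 \<notin> {1, 2}" if "j < i" for j
    using that by (auto simp: flips_def)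
  have i: "0 < i" using x q by (cases i) auto
  have d: "4 * y div q = (if 4 * y < q then 0 else if 4 * y < 2 * q then 1 else if 4 * y < 3 * q then 2 else 3)"
    if "y < q" for y
  proof -
    have *: "4 * y div q = k" if "k * q \<le> 4 * y" "4 * y < Suc k * q" for k
      using that by (intro div_nat_eqI) (simp_all add: mult.commute)
    show ?thesis using *[of 0] *[of 1] *[of 2] *[of 3] that by auto
  qed
  consider "4 * x < q" | "3 * q \<le> 4 * x"
    using no[of 0] d[OF x(2)] i x by (auto split: if_splits)
  then show False
  proof cases
    case 1
    have "4 * 2 ^ j * x < q" if "j < i" for j
      using that
    proof (induction j)
      case (Suc j)
      then have "4 * (2 ^ Suc j * x) < 2 * q" by (simp add: mult_ac)
      moreover have "2 ^ Suc j * x < q" using Suc by (simp add: mult_ac)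
      ultimately show ?case using no[of "Suc j"] Suc.prems d[of "2 ^ Suc j * x"]
        by (auto split: if_splits simp: mult.assoc)
    qed (use 1 in simp)
    from this[of "i - 1"] have "4 * 2 ^ (i - 1) * x < 2 ^ Suc i" using i q by linarith
    moreover have "(4::nat) * 2 ^ (i - 1) = 2 ^ Suc i" using i by (cases i) auto
    ultimately have "2 ^ Suc i * x < 2 ^ Suc i * 1" by (simp only: mult_1_right)
    then show False using x by (subst (asm) nat_mult_less_cancel1) auto
  next
    case 2
    define z where "z = q - x"
    have z: "x = q - z" "0 < z" "4 * z \<le> q" "z \<le> q" using 2 x by (auto simp: z_def)
    have "4 * 2 ^ j * z \<le> q" if "j < i" for j
      using that
    proof (induction j)
      case (Suc j)
      then have le: "4 * (2 ^ Suc j * z) \<le> 2 * q" "4 * 2 ^ j * z \<le> q" by (simp_all add: mult_ac)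
      then have lt: "2 ^ Suc j * z < q" using x by simp
      have "2 ^ (Suc j + 2) * x = 4 * (q - 2 ^ Suc j * z) + q * (4 * (2 ^ Suc j - 1))"
      proof -
        have "int (2 ^ (Suc j + 2) * x) = int (4 * (q - 2 ^ Suc j * z) + q * (4 * (2 ^ Suc j - 1)))"
          using lt z by (simp add: of_nat_diff algebra_simps)
        then show ?thesis by (simp only: of_nat_eq_iff)
      qed
      then have "2 ^ (Suc j + 2) * x div q mod 4 = 4 * (q - 2 ^ Suc j * z) div q mod 4"
        using x by simp
      moreover have "q - 2 ^ Suc j * z < q" using z lt by simp
      ultimately show ?case using no[of "Suc j"] Suc.prems d[of "q - 2 ^ Suc j * z"] le lt
        by (auto split: if_splits)
    qed (use z in simp)
    from this[of "i - 1"] have "4 * 2 ^ (i - 1) * z < 2 ^ Suc i" using i q by linarith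
    moreover have "(4::nat) * 2 ^ (i - 1) = 2 ^ Suc i" using i by (cases i) auto
    ultimately have "2 ^ Suc i * z < 2 ^ Suc i * 1" by (simp only: mult_1_right)
    then show False using z by (subst (asm) nat_mult_less_cancel1) auto
  qed
qed

text \<open>The number of adjacent unequal digits among the last \<open>M + 1\<close> binary digits of \<open>a\<close>.\<close>

primrec changes :: "nat \<Rightarrow> nat \<Rightarrow> nat" where
  "changes 0 a = 0"
| "changes (Suc M) a = changes M (a div 2) + (if a mod 4 \<in> {1, 2} then 1 else 0)"

lemma flips_eq_changes: "flips M x q = changes M (2 ^ (M + 1) * x div q)"
proof (induction M)
  case (Suc M)
  have "2 ^ (Suc M + 1) * x div q div 2 = 2 * (2 ^ (M + 1) * x) div (2 * q)"
    by (simp add: div_mult2_eq[symmetric] mult_ac)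
  also have "\<dots> = 2 ^ (M + 1) * x div q" by (rule div_mult_mult1) simp
  finally show ?case by (simp add: flips_Suc Suc)
qed simp

lemma sum_lessThan_double:
  "(\<Sum>a<2 * n. F a) = (\<Sum>a<n. F (2 * a) + F (2 * a + 1))" for F :: "nat \<Rightarrow> real"
  by (induction n) simp_all

text \<open>Appending a digit creates a change for exactly one of its two values. Thus \<open>changes M\<close> is binomially
  distributed.\<close>

lemma sum_power_changes:
  fixes y :: real
  shows "(\<Sum>a<2 ^ (M + 1). y ^ changes M a) = 2 * (1 + y) ^ M"
proof (induction M)
  case (Suc M)
  have "y ^ changes (Suc M) (2 * a) + y ^ changes (Suc M) (2 * a + 1) = (1 + y) * y ^ changes M a" for a
  proof (cases "even a")
    case True
    then have "(2 * a) mod 4 = 0" "(2 * a + 1) mod 4 = 1" by presburger+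
    then show ?thesis by (simp add: algebra_simps)
  next
    case False
    then have "(2 * a) mod 4 = 2" "(2 * a + 1) mod 4 = 3" by presburger+
    then show ?thesis by (simp add: algebra_simps)
  qed
  then have "(\<Sum>a<2 * 2 ^ (M + 1). y ^ changes (Suc M) a) = (\<Sum>a<2 ^ (M + 1). (1 + y) * y ^ changes M a)"
    unfolding sum_lessThan_double by (intro sum.cong refl)
  also have "\<dots> = (1 + y) * (\<Sum>a<2 ^ (M + 1). y ^ changes M a)"
    by (rule sum_distrib_left[symmetric])
  finally show ?case unfolding Suc by simp
qed simp

lemma card_few_changes:
  fixes y s :: real
  assumes "0 < y" "y \<le> 1"
  shows "real (card {a. a < 2 ^ (M + 1) \<and> real (changes M a) < s}) \<le> 2 * (1 + y) ^ M * y powr (- s)"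
proof -
  let ?A = "{a. a < 2 ^ (M + 1) \<and> real (changes M a) < s}"
  have "real (card ?A) * y powr s = (\<Sum>a\<in>?A. y powr s)" by simp
  also have "\<dots> \<le> (\<Sum>a\<in>?A. y ^ changes M a)"
    by (intro sum_mono) (use assms in \<open>auto simp: powr_realpow[symmetric] intro!: powr_mono'\<close>)
  also have "\<dots> \<le> (\<Sum>a<2 ^ (M + 1). y ^ changes M a)"
    by (intro sum_mono2) (use assms in auto)
  finally show ?thesis
    unfolding sum_power_changes using assms by (simp add: powr_minus field_simps)
qed

text \<open>Distinct fractions with denominators below \<open>2^(i+1)\<close> are more than \<open>4^-(i+1)\<close> apart, so \<open>2i + 2\<close> binary
  digits determine the fraction, and the denominator if it is reduced.\<close>

lemma fraction_digits_inj:
  fixes r d r' d' :: nat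
  assumes "coprime r d" "coprime r' d'" "0 < d" "0 < d'" "d < 2 ^ (i + 1)" "d' < 2 ^ (i + 1)"
    and eq: "2 ^ (2 * i + 2) * r div d = 2 ^ (2 * i + 2) * r' div d'"
  shows "d = d'"
proof -
  define b where "b = 2 ^ (2 * i + 2) * r div d"
  have *: "r1 * d2 \<le> r2 * d1"
    if b: "b = 2 ^ (2 * i + 2) * r1 div d1" "b = 2 ^ (2 * i + 2) * r2 div d2"
      and d: "0 < d1" "0 < d2" "d1 < 2 ^ (i + 1)" "d2 < 2 ^ (i + 1)" for r1 d1 r2 d2 :: nat
  proof (rule ccontr)
    assume "\<not> ?thesis"
    then have "r2 * d1 + 1 \<le> r1 * d2" by simp
    define X :: nat where "X = 2 ^ (2 * i + 2)"
    have "X * (r2 * d1 + 1) \<le> X * (r1 * d2)" by (rule mult_le_mono2) fact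
    then have 1: "X * (r2 * d1) + X \<le> X * (r1 * d2)" by (simp only: distrib_left mult_1_right)
    have "X * r1 < (b + 1) * d1"
      using dividend_less_div_times[OF d(1), of "X * r1"] b(1) by (simp add: X_def add.commute)
    then have "X * r1 * d2 < (b + 1) * d1 * d2" using d(2) by (rule mult_strict_right_mono)
    then have 2: "X * (r1 * d2) < b * (d1 * d2) + d1 * d2" by (simp only: mult.assoc distrib_right mult_1_left)
    have "b * d2 \<le> X * r2" unfolding b(2) X_def by (rule div_times_less_eq_dividend)
    then have "b * d2 * d1 \<le> X * r2 * d1" by (rule mult_le_mono1)
    then have 3: "b * (d1 * d2) \<le> X * (r2 * d1)" by (simp only: mult.assoc mult.commute[of d2 d1])
    have "d1 * d2 < 2 ^ (i + 1) * 2 ^ (i + 1)" using d by (intro mult_strict_mono) auto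
    also have "\<dots> = X" by (simp only: X_def power_add[symmetric]) (simp add: mult_2)
    finally show False using 1 2 3 by linarith
  qed
  have "r * d' = r' * d"
    using *[of r d r' d'] *[of r' d' r d] assms eq by (simp add: b_def le_antisym)
  then have "d dvd d'" "d' dvd d"
    using assms(1,2) by (metis coprime_commute coprime_dvd_mult_right_iff dvd_triv_right)+
  then show ?thesis by (rule dvd_antisym)
qed

definition flat_denoms :: "nat \<Rightarrow> nat \<Rightarrow> real \<Rightarrow> nat set" where
  "flat_denoms i M s = {d. 2 ^ i \<le> d \<and> d < 2 ^ (i + 1) \<and>
     (\<exists>r<d. coprime r d \<and> real (flips M r d) < s)}"

text \<open>The first \<open>M + 1\<close> digits of the fraction have few changes, which a Chernoff bound with parameter \<open>y\<close>
  counts; the other \<open>2i + 1 - M\<close> of the digits that determine the denominator are arbitrary.\<close>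

lemma card_flat_denoms:
  assumes M: "M \<le> 2 * i + 1" and y: "0 < y" "y \<le> 1"
  shows "real (card (flat_denoms i M s)) \<le> 2 ^ (2 * i + 1 - M) * (2 * (1 + y) ^ M * y powr (- s))"
proof -
  define e where "e = 2 * i + 1 - M"
  let ?A = "{a. a < 2 ^ (M + 1) \<and> real (changes M a) < s}"
  have "\<forall>d\<in>flat_denoms i M s. \<exists>r. r < d \<and> coprime r d \<and> real (flips M r d) < s"
    by (auto simp: flat_denoms_def)
  then obtain r where r: "\<And>d. d \<in> flat_denoms i M s \<Longrightarrow> r d < d \<and> coprime (r d) d \<and> real (flips M (r d) d) < s"
    by (metis (no_types, lifting))
  define b where "b d = 2 ^ (2 * i + 2) * r d div d" for d
  have e: "2 * i + 2 = (M + 1) + e" using M by (simp add: e_def)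
  have bdiv: "b d div 2 ^ e = 2 ^ (M + 1) * r d div d" for d
  proof -
    have "b d div 2 ^ e = 2 ^ e * (2 ^ (M + 1) * r d) div (2 ^ e * d)"
      unfolding b_def e by (simp add: div_mult2_eq[symmetric] power_add mult_ac)
    then show ?thesis by simp
  qed
  have "card (flat_denoms i M s) \<le> card (?A \<times> {..<2 ^ e :: nat})"
  proof (rule card_inj_on_le)
    show "inj_on (\<lambda>d. (b d div 2 ^ e, b d mod 2 ^ e)) (flat_denoms i M s)"
    proof (rule inj_onI)
      fix d d' assume d: "d \<in> flat_denoms i M s" "d' \<in> flat_denoms i M s"
        and eq: "(b d div 2 ^ e, b d mod 2 ^ e) = (b d' div 2 ^ e, b d' mod 2 ^ e)"
      then have "b d = b d'" by (metis Pair_inject div_mult_mod_eq)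
      then show "d = d'"
        using fraction_digits_inj[of "r d" d "r d'" d' i] r[OF d(1)] r[OF d(2)] d
        by (auto simp: b_def flat_denoms_def)
    qed
    show "(\<lambda>d. (b d div 2 ^ e, b d mod 2 ^ e)) ` flat_denoms i M s \<subseteq> ?A \<times> {..<2 ^ e}"
    proof (clarsimp simp: bdiv)
      fix d assume "d \<in> flat_denoms i M s"
      then have "r d < d" "real (flips M (r d) d) < s" using r by auto
      then show "2 * 2 ^ M * r d div d < 2 * 2 ^ M \<and> real (changes M (2 * 2 ^ M * r d div d)) < s"
        by (auto simp: flips_eq_changes less_mult_imp_div_less)
    qed
  qed auto
  then have "card (flat_denoms i M s) \<le> card ?A * 2 ^ e" by (simp only: card_cartesian_product card_lessThan)
  then have "real (card (flat_denoms i M s)) \<le> real (card ?A * 2 ^ e)" by (rule of_nat_mono)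
  then have "real (card (flat_denoms i M s)) \<le> real (card ?A) * 2 ^ e" by simp
  also have "\<dots> \<le> (2 * (1 + y) ^ M * y powr (- s)) * 2 ^ e"
    by (intro mult_right_mono card_few_changes y) simp
  finally show ?thesis by (simp add: e_def mult.commute)
qed

lemma card_multiples_le: "0 < d \<Longrightarrow> real (card {q. 0 < q \<and> q \<le> Q \<and> d dvd q}) \<le> real Q / real d"
  for d Q :: nat
proof -
  assume d: "0 < d"
  have "{q. 0 < q \<and> q \<le> Q \<and> d dvd q} \<subseteq> (*) d ` {1..Q div d}"
  proof
    fix q assume "q \<in> {q. 0 < q \<and> q \<le> Q \<and> d dvd q}"
    then have q: "0 < q" "q \<le> Q" "d dvd q" by auto
    have "0 < q div d" using q d by (simp add: div_greater_zero_iff dvd_imp_le)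
    then have "q div d \<in> {1..Q div d}" using q(2) div_le_mono[of q Q d] by simp
    then show "q \<in> (*) d ` {1..Q div d}" using q(3) by (metis dvd_mult_div_cancel imageI)
  qed
  then have "card {q. 0 < q \<and> q \<le> Q \<and> d dvd q} \<le> card ((*) d ` {1..Q div d})"
    by (intro card_mono) auto
  also have "\<dots> \<le> Q div d" using card_image_le[of "{1..Q div d}" "(*) d"] by simp
  finally have "real (card {q. 0 < q \<and> q \<le> Q \<and> d dvd q}) \<le> real (Q div d)" by simp
  also have "\<dots> \<le> real Q / real d" by (rule of_nat_div_le_of_nat)
  finally show ?thesis .
qed

text \<open>In lowest terms let \<open>x / q = r / d\<close>, with \<open>d\<close> of size \<open>2^i\<close>. Cut the \<open>N\<close> digits into windows of about
  \<open>(1 + \<kappa>) i\<close> digits. Some window has at most twice the average number of changes, and moving it to the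
  front multiplies \<open>r\<close> by a power of 2, which keeps \<open>r / d\<close> reduced because \<open>d\<close> is odd. So \<open>N\<close>
  disappears from the problem. By \<open>flips_pos\<close> every window has a change, and therefore \<open>i\<close> is large
  if \<open>\<epsilon>\<close> is small.\<close>

lemma flat_denom_exists:
  fixes \<epsilon> \<kappa> :: real
  assumes \<kappa>: "0 < \<kappa>" "\<kappa> \<le> 1" and q: "odd q" "0 < x" "x < q"
    and fl: "real (flips N x q) < \<epsilon> * N" and N: "(1 + \<kappa>) * log 2 (real q) \<le> N"
  shows "\<exists>i d. d dvd q \<and> 1 < 4 * \<epsilon> * i \<and> d \<in> flat_denoms i (nat \<lceil>(1 + \<kappa>) * i\<rceil>) (2 * \<epsilon> * nat \<lceil>(1 + \<kappa>) * i\<rceil>)"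
proof -
  define g where "g = gcd x q"
  define r d where "r = x div g" and "d = q div g"
  have g: "0 < g" "x = g * r" "q = g * d" using q by (auto simp: g_def r_def d_def)
  have rd: "coprime r d" unfolding r_def d_def g_def using q by (intro div_gcd_coprime) auto
  have rd': "0 < r" "r < d" "odd d" using g q by auto
  obtain i where i: "2 ^ i \<le> d" "d < 2 ^ (i + 1)"
    using ex_power_ivl1[of 2 d] rd' by auto
  have "0 < i" using i rd' by (cases i) auto
  define M where "M = nat \<lceil>(1 + \<kappa>) * i\<rceil>"
  have M: "(1 + \<kappa>) * i \<le> M" unfolding M_def by linarith
  have "(1 + \<kappa>) * i \<le> 2 * real i" using \<kappa> by (intro mult_right_mono) auto
  then have M2: "M \<le> 2 * i" unfolding M_def by linarith
  have iM: "i \<le> M" 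
  proof -
    have "1 * real i \<le> (1 + \<kappa>) * i" using \<kappa> by (intro mult_right_mono) auto
    then show ?thesis using M by linarith
  qed
  have "real i \<le> log 2 d" using i rd' by (simp add: le_log2_of_power)
  also have "\<dots> \<le> log 2 q" using g q by (simp add: Suc_leI)
  finally have "(1 + \<kappa>) * i \<le> N" using N \<kappa> mult_left_mono[of i "log 2 q" "1 + \<kappa>"] by linarith
  then have MN: "M \<le> N" unfolding M_def by linarith
  define K where "K = N div M"
  have K: "0 < K" "M * K \<le> N" "N < M * (K + 1)"
    using MN iM \<open>0 < i\<close> dividend_less_div_times[of M N] by (auto simp: K_def div_greater_zero_iff mult.commute)
  then have N2: "N \<le> 2 * (M * K)" 
  proof -
    have "M * 1 \<le> M * K" using K by (intro mult_le_mono2) simp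
    moreover have "N < M * K + M" using K by simp
    ultimately show ?thesis by linarith
  qed
  have \<epsilon>: "0 < \<epsilon>" 
  proof (rule ccontr)
    assume "\<not> 0 < \<epsilon>"
    then have "\<epsilon> * N \<le> 0" by (intro mult_nonpos_nonneg) auto
    then show False using fl by linarith
  qed
  have "\<exists>j<K. real (flips M (2 ^ (M * j) * r) d) < 2 * \<epsilon> * M"
  proof (rule ccontr)
    assume "\<not> ?thesis"
    then have "(\<Sum>j<K. 2 * \<epsilon> * M) \<le> (\<Sum>j<K. real (flips M (2 ^ (M * j) * r) d))"
      by (intro sum_mono) (meson lessThan_iff not_less)
    also have "\<dots> = real (flips (M * K) r d)" by (simp add: flips_blocks)
    also have "\<dots> \<le> real (flips N r d)" using K by (simp add: flips_mono)
    also have "\<dots> = real (flips N x q)" using g by (simp add: flips_mult_cancel)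
    finally have "2 * \<epsilon> * (M * K) < \<epsilon> * N" using fl by (simp add: mult_ac)
    also have "\<epsilon> * N \<le> \<epsilon> * (2 * (M * K))" using N2 \<epsilon> by (intro mult_left_mono) linarith+
    finally show False by simp
  qed
  then obtain j where j: "real (flips M (2 ^ (M * j) * r) d) < 2 * \<epsilon> * M" by blast
  define r' where "r' = 2 ^ (M * j) * r mod d"
  have cop: "coprime r' d" unfolding r'_def using rd rd' by simp
  have r': "r' < d" "real (flips M r' d) < 2 * \<epsilon> * M" using rd' j by (auto simp: r'_def flips_mod)
  have "0 < r'" using cop rd' by (intro gr0I) auto
  then have "0 < flips i r' d" using r' i by (intro flips_pos) auto
  then have "1 \<le> real (flips M r' d)" using flips_mono[OF iM, of r' d] by linarith
  then have "1 < 2 * \<epsilon> * M" using r' by linarith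
  also have "\<dots> \<le> 2 * \<epsilon> * (2 * i)" using M2 \<epsilon> by (intro mult_left_mono) linarith+
  finally have "1 < 4 * \<epsilon> * i" by simp
  moreover have "d \<in> flat_denoms i M (2 * \<epsilon> * M)"
    unfolding flat_denoms_def using i r' cop by blast
  ultimately show ?thesis unfolding M_def[symmetric] using g by (intro exI[of _ i] exI[of _ d]) (auto simp: M_def)
qed

text \<open>There are at most \<open>4 \<rho>^i 2^i\<close> flat denominators of size \<open>2^i\<close> with a constant \<open>\<rho> < 1\<close>: the exponent
  \<open>\<kappa>\<close> wins over the losses \<open>(1 + y)^M\<close> and \<open>y^(-s)\<close> of the Chernoff bound if \<open>y\<close> and then \<open>\<epsilon>\<close> are small.
  Each of them has at most \<open>Q / 2^i\<close> multiples, and only \<open>i > 1 / (4 \<epsilon>)\<close> occur.\<close>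

lemma few_flips_rare:
  fixes \<kappa> \<eta> :: real
  assumes \<kappa>: "0 < \<kappa>" "\<kappa> \<le> 1" and \<eta>: "0 < \<eta>"
  shows "\<exists>\<epsilon>::real. 0 < \<epsilon> \<and> (\<forall>Q N :: nat. (1 + \<kappa>) * log 2 (real Q) \<le> N \<longrightarrow>
    real (card {q. odd q \<and> q \<le> Q \<and> (\<exists>x. 0 < x \<and> x < q \<and> real (flips N x q) < \<epsilon> * N)}) \<le> \<eta> * Q)"
proof -
  define \<rho> where "\<rho> = 2 powr (- \<kappa> / 3)"
  have \<rho>: "0 < \<rho>" "\<rho> < 1" using \<kappa> by (auto simp: \<rho>_def powr_less_one)
  define y where "y = min 1 (2 powr (\<kappa> / 6) - 1)"
  have "1 < 2 powr (\<kappa> / 6)" using \<kappa> by simp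
  then have y: "0 < y" "y \<le> 1" "1 + y \<le> 2 powr (\<kappa> / 6)" by (auto simp: y_def)
  have "(\<lambda>n. 4 * \<rho> ^ n / (1 - \<rho>)) \<longlonglongrightarrow> 4 * 0 / (1 - \<rho>)"
    using \<rho> by (intro tendsto_intros LIMSEQ_power_zero) auto
  then have "\<forall>\<^sub>F n in sequentially. 4 * \<rho> ^ n / (1 - \<rho>) < \<eta>" using \<eta> by (auto dest: order_tendstoD(2))
  then obtain i0 where i0: "4 * \<rho> ^ i0 / (1 - \<rho>) < \<eta>" "0 < i0"
    using eventually_happens'[OF sequentially_bot eventually_conj[OF _ eventually_gt_at_top[of "0::nat"]]] by blast
  have "((\<lambda>\<epsilon>. y powr (- (4 * \<epsilon>))) \<longlongrightarrow> y powr (- (4 * 0))) (at_right 0)"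
    using y by (intro tendsto_intros) auto
  then have "\<forall>\<^sub>F \<epsilon> in at_right 0. y powr (- (4 * \<epsilon>)) < 2 powr (\<kappa> / 3)"
    using y \<kappa> by (auto dest!: order_tendstoD(2)[where a = "2 powr (\<kappa> / 3)"])
  moreover have "\<forall>\<^sub>F \<epsilon> in at_right 0. (\<epsilon>::real) < 1 / (4 * i0)"
    using i0 by (intro eventually_at_right_real[THEN eventually_mono]) auto
  moreover have "\<forall>\<^sub>F \<epsilon> in at_right 0. (0::real) < \<epsilon>" by (simp add: eventually_at_right_less)
  ultimately have "\<forall>\<^sub>F \<epsilon> in at_right 0. 0 < \<epsilon> \<and> \<epsilon> < 1 / (4 * i0) \<and> y powr (- (4 * \<epsilon>)) < 2 powr (\<kappa> / 3)"
    by eventually_elim auto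
  then obtain \<epsilon> where \<epsilon>: "0 < \<epsilon>" "\<epsilon> < 1 / (4 * i0)" "y powr (- (4 * \<epsilon>)) < 2 powr (\<kappa> / 3)"
    using eventually_happens'[OF trivial_limit_at_right_real] by blast
  define M where "M i = nat \<lceil>(1 + \<kappa>) * real i\<rceil>" for i
  define D where "D i = flat_denoms i (M i) (2 * \<epsilon> * M i)" for i
  have finD: "finite (D i)" for i by (rule finite_subset[of _ "{..<2 ^ (i + 1)}"]) (auto simp: D_def flat_denoms_def)
  have cardD: "real (card (D i)) \<le> 4 * \<rho> ^ i * 2 ^ i" for i
  proof -
    have M: "(1 + \<kappa>) * i \<le> M i" unfolding M_def by linarith
    have "(1 + \<kappa>) * i \<le> 2 * real i" using \<kappa> by (intro mult_right_mono) auto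
    then have M2: "M i \<le> 2 * i" unfolding M_def by linarith
    have "real (card (D i)) \<le> 2 ^ (2 * i + 1 - M i) * (2 * (1 + y) ^ M i * y powr (- (2 * \<epsilon> * M i)))"
      unfolding D_def using M2 y by (intro card_flat_denoms) auto
    also have "\<dots> \<le> (2 * 2 powr ((1 - \<kappa>) * i)) * (2 * 2 powr (\<kappa> / 3 * i) * 2 powr (\<kappa> / 3 * i))"
    proof (intro mult_mono)
      have "(2::real) ^ (2 * i + 1 - M i) = 2 powr (real (2 * i + 1 - M i))" by (simp add: powr_realpow)
      also have "\<dots> \<le> 2 powr (1 + (1 - \<kappa>) * i)"
        using M M2 by (intro powr_mono) (auto simp: of_nat_diff algebra_simps)
      finally show "(2::real) ^ (2 * i + 1 - M i) \<le> 2 * 2 powr ((1 - \<kappa>) * i)" by (simp add: powr_add)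
      have "(1 + y) ^ M i \<le> (1 + y) ^ (2 * i)" using y M2 by (intro power_increasing) auto
      also have "\<dots> \<le> (2 powr (\<kappa> / 6)) ^ (2 * i)" using y by (intro power_mono) auto
      also have "\<dots> = 2 powr (\<kappa> / 3 * i)" by (simp add: powr_powr powr_realpow[symmetric])
      finally show "(1 + y) ^ M i \<le> 2 powr (\<kappa> / 3 * i)" .
      have "y powr (- (2 * \<epsilon> * M i)) \<le> y powr (- (4 * \<epsilon>) * i)"
        using y M2 \<epsilon> by (intro powr_mono') auto
      also have "\<dots> = (y powr (- (4 * \<epsilon>))) powr i" by (simp add: powr_powr)
      also have "\<dots> \<le> (2 powr (\<kappa> / 3)) powr i" using \<epsilon> by (intro powr_mono2) auto
      also have "\<dots> = 2 powr (\<kappa> / 3 * i)" by (simp add: powr_powr)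
      finally show "y powr (- (2 * \<epsilon> * M i)) \<le> 2 powr (\<kappa> / 3 * i)" .
    qed (use y in auto)
    also have "\<dots> = 4 * (2 powr ((1 - \<kappa>) * i) * 2 powr (\<kappa> / 3 * i) * 2 powr (\<kappa> / 3 * i))" by simp
    also have "2 powr ((1 - \<kappa>) * i) * 2 powr (\<kappa> / 3 * i) * 2 powr (\<kappa> / 3 * i) = 2 powr (- \<kappa> / 3 * i + i)"
      by (simp add: powr_add[symmetric] algebra_simps)
    also have "\<dots> = 2 powr (- \<kappa> / 3 * i) * 2 powr i" by (rule powr_add)
    also have "\<dots> = \<rho> ^ i * 2 ^ i" by (simp add: \<rho>_def powr_powr flip: powr_realpow)
    finally show ?thesis by simp
  qed
  show ?thesis
  proof (intro exI[of _ \<epsilon>] conjI allI impI)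
    fix Q N :: nat assume N: "(1 + \<kappa>) * log 2 (real Q) \<le> N"
    let ?S = "{q. odd q \<and> q \<le> Q \<and> (\<exists>x. 0 < x \<and> x < q \<and> real (flips N x q) < \<epsilon> * N)}"
    let ?m = "\<lambda>d. {q. 0 < q \<and> q \<le> Q \<and> d dvd q}"
    have fin: "finite (?m d)" for d by (rule finite_subset[of _ "{..Q}"]) auto
    have "?S \<subseteq> (\<Union>i\<in>{i0..Q}. \<Union>d\<in>D i. ?m d)"
    proof
      fix q assume "q \<in> ?S"
      then obtain x where q: "odd q" "q \<le> Q" "0 < x" "x < q" "real (flips N x q) < \<epsilon> * N" by auto
      have "log 2 q \<le> log 2 Q" using q by simp
      then have "(1 + \<kappa>) * log 2 q \<le> N" using N \<kappa> mult_left_mono[of "log 2 q" "log 2 Q" "1 + \<kappa>"] by linarith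
      from flat_denom_exists[OF \<kappa> q(1,3,4,5) this] obtain i d where
        i: "d dvd q" "1 < 4 * \<epsilon> * i" "d \<in> D i" by (auto simp: D_def M_def)
      have "4 * \<epsilon> * i0 < 1" using \<epsilon> i0 by (simp add: field_simps)
      then have "4 * \<epsilon> * i0 < 4 * \<epsilon> * i" using i by linarith
      then have "i0 \<le> i" using \<epsilon> by simp
      moreover have "2 ^ i \<le> d" using i by (simp add: D_def flat_denoms_def)
      then have "i < Q" using i q dvd_imp_le[of d q] less_exp[of i] by linarith
      ultimately show "q \<in> (\<Union>i\<in>{i0..Q}. \<Union>d\<in>D i. ?m d)" using i q by (intro UN_I[of i] UN_I[of d]) auto
    qed
    then have "card ?S \<le> card (\<Union>i\<in>{i0..Q}. \<Union>d\<in>D i. ?m d)"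
      by (rule card_mono[rotated]) (use finD fin in auto)
    also have "\<dots> \<le> (\<Sum>i\<in>{i0..Q}. \<Sum>d\<in>D i. card (?m d))"
      by (intro card_UN_le[THEN order_trans] sum_mono finD) auto
    finally have "real (card ?S) \<le> (\<Sum>i\<in>{i0..Q}. \<Sum>d\<in>D i. real (card (?m d)))"
      by (simp only: of_nat_sum[symmetric] of_nat_le_iff)
    also have "\<dots> \<le> (\<Sum>i\<in>{i0..Q}. \<Sum>d\<in>D i. Q / 2 ^ i)"
    proof (intro sum_mono)
      fix i d assume "d \<in> D i"
      then have d: "2 ^ i \<le> d" "0 < d" by (auto simp: D_def flat_denoms_def intro: less_le_trans[of 0 "2 ^ i"])
      then have "real (card (?m d)) \<le> Q / d" by (intro card_multiples_le)
      also have "\<dots> \<le> Q / 2 ^ i" using d by (intro divide_left_mono) (auto simp: of_nat_le_iff[symmetric] simp del: of_nat_le_iff)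
      finally show "real (card (?m d)) \<le> Q / 2 ^ i" .
    qed
    also have "\<dots> = (\<Sum>i\<in>{i0..Q}. card (D i) * (Q / 2 ^ i))" by simp
    also have "\<dots> \<le> (\<Sum>i\<in>{i0..Q}. (4 * \<rho> ^ i * 2 ^ i) * (Q / 2 ^ i))"
      by (intro sum_mono mult_right_mono cardD) auto
    also have "\<dots> = 4 * Q * (\<Sum>i\<in>{i0..Q}. \<rho> ^ i)" by (simp add: sum_distrib_left mult_ac)
    also have "\<dots> \<le> 4 * Q * (\<rho> ^ i0 / (1 - \<rho>))"
      using \<rho> by (intro mult_left_mono) (auto simp: sum_gp divide_right_mono)
    also have "\<dots> = 4 * \<rho> ^ i0 / (1 - \<rho>) * Q" by simp
    also have "\<dots> \<le> \<eta> * Q" using i0 by (intro mult_right_mono) auto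
    finally show "real (card ?S) \<le> \<eta> * Q" .
  qed (use \<epsilon> in auto)
qed

section \<open>The number of divisors\<close>

definition num_divisors :: "nat \<Rightarrow> nat" where "num_divisors n = card {d. d dvd n}"

lemma num_divisors_mult: "0 < m \<Longrightarrow> 0 < n \<Longrightarrow> num_divisors (m * n) \<le> num_divisors m * num_divisors n"
proof -
  assume "0 < m" "0 < n"
  then have fin: "finite ({d. d dvd m} \<times> {d. d dvd n})" by (simp add: finite_divisors_nat)
  have "{d. d dvd m * n} \<subseteq> (\<lambda>(a, b). a * b) ` ({d. d dvd m} \<times> {d. d dvd n})"
  proof
    fix d assume "d \<in> {d. d dvd m * n}"
    then obtain a b where "d = a * b" "a dvd m" "b dvd n" using division_decomp[of d m n] by auto
    then show "d \<in> (\<lambda>(a, b). a * b) ` ({d. d dvd m} \<times> {d. d dvd n})" by (intro image_eqI[of _ _ "(a, b)"]) auto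
  qed
  from surj_card_le[OF fin this] show ?thesis
    by (simp add: num_divisors_def card_cartesian_product)
qed

lemma num_divisors_prime_power: "prime p \<Longrightarrow> num_divisors (p ^ k) \<le> k + 1"
proof -
  assume p: "prime p"
  have "{d. d dvd p ^ k} \<subseteq> (\<lambda>i. p ^ i) ` {..k}" using p by (auto simp: divides_primepow_nat)
  from surj_card_le[OF _ this] show ?thesis by (simp add: num_divisors_def)
qed

text \<open>The number of divisors is submultiplicative, and \<open>p^k\<close> has \<open>k + 1 \<le> p^(\<epsilon> k)\<close> divisors as soon as
  \<open>p \<ge> exp (1 / \<epsilon>)\<close>. Each of the finitely many smaller primes costs a further constant factor \<open>K\<close>.\<close>

lemma divisor_bound:
  fixes \<epsilon> :: real
  assumes "0 < \<epsilon>"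
  shows "\<exists>c>0. \<forall>n>0. real (num_divisors n) \<le> c * real n powr \<epsilon>"
proof -
  define K where "K = 1 + 1 / (\<epsilon> * ln 2)"
  have K: "1 \<le> K" using assms by (simp add: K_def)
  have bern: "1 + x * ln b \<le> b powr x" if "0 < b" for b x :: real
    using exp_ge_add_one_self[of "x * ln b"] that by (simp add: powr_def)
  have small: "real k + 1 \<le> K * real p powr (\<epsilon> * k)" if "2 \<le> p" for p k :: nat
  proof -
    have "real k + 1 \<le> K * (1 + \<epsilon> * k * ln 2)"
      using assms K by (simp add: K_def field_simps add_increasing)
    also have "\<dots> \<le> K * 2 powr (\<epsilon> * k)" using bern[of 2 "\<epsilon> * k"] K by (intro mult_left_mono) auto
    also have "\<dots> \<le> K * real p powr (\<epsilon> * k)" using K assms that by (intro mult_left_mono powr_mono2) auto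
    finally show ?thesis .
  qed
  have large: "real k + 1 \<le> real p powr (\<epsilon> * k)" if "exp (1 / \<epsilon>) \<le> p" for p k :: nat
  proof -
    have p: "0 < real p" using that by (rule less_le_trans[rotated]) simp
    then have "1 / \<epsilon> \<le> ln p" using that by (simp add: ln_ge_iff)
    then have "1 \<le> \<epsilon> * ln p" using assms by (simp add: field_simps)
    then have "real k * 1 \<le> real k * (\<epsilon> * ln p)" by (intro mult_left_mono) auto
    then show ?thesis using bern[OF p, of "\<epsilon> * k"] by (simp add: mult_ac)
  qed
  define S where "S = {p. prime p \<and> real p < exp (1 / \<epsilon>)}"
  have fS: "finite S" 
    by (rule finite_subset[of _ "{..nat \<lceil>exp (1 / \<epsilon>)\<rceil>}"]) (auto simp: S_def, linarith)
  have main: "real (num_divisors n) \<le> K ^ card {p\<in>S. p dvd n} * real n powr \<epsilon>" if "0 < n" for n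
    using that
  proof (induction n rule: less_induct)
    case (less n)
    show ?case
    proof (cases "n = 1")
      case True
      have "\<not> p dvd 1" if "p \<in> S" for p :: nat using that by (auto simp: S_def)
      then show ?thesis using True K by (simp add: num_divisors_def one_le_power)
    next
      case False
      then obtain p where p: "prime p" "p dvd n" using prime_factor_nat by blast
      define k where "k = multiplicity p n"
      have "n \<noteq> 0" "\<not> is_unit p" using less.prems p by auto
      then obtain m where m: "n = p ^ k * m" "\<not> p dvd m"
        unfolding k_def by (rule multiplicity_decompose')
      have "m > 0" using m(1) \<open>n \<noteq> 0\<close> by (cases "m = 0") auto
      have k: "0 < k" using m p by (cases "k = 0") auto
      have "1 < p ^ k" using one_less_power[OF prime_gt_1_nat[OF p(1)] k] .
      then have "m < n" unfolding m(1) using \<open>0 < m\<close> by simp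
      have p0: "0 < p" using p by (simp add: prime_gt_0_nat)
      define w where "w = (if p \<in> S then K else 1)"
      have "real k + 1 \<le> w * real p powr (\<epsilon> * k)"
        using small[of p k] large[of p k] p by (auto simp: w_def S_def prime_ge_2_nat)
      also have "real p powr (\<epsilon> * k) = real (p ^ k) powr \<epsilon>"
        using p0 by (simp add: powr_powr mult.commute flip: powr_realpow)
      finally have w: "real k + 1 \<le> w * real (p ^ k) powr \<epsilon>" .
      have cd: "K ^ card {p\<in>S. p dvd n} = w * K ^ card {p\<in>S. p dvd m}"
      proof -
        have "x dvd n \<longleftrightarrow> x = p \<or> x dvd m" if "x \<in> S" for x
          using that p(1) k primes_dvd_imp_eq[of x p] prime_dvd_power[of x p k]
          unfolding m(1) by (auto simp: S_def prime_dvd_mult_iff dvd_power)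
        then have *: "{p\<in>S. p dvd n} = (if p \<in> S then {p} else {}) \<union> {p\<in>S. p dvd m}"
          by auto
        show ?thesis unfolding * using m(2) fS by (simp add: w_def)
      qed
      have "real (num_divisors n) \<le> real (num_divisors (p ^ k)) * real (num_divisors m)"
        using num_divisors_mult[of "p ^ k" m] \<open>0 < m\<close> p0 unfolding m(1) by (simp flip: of_nat_mult)
      also have "\<dots> \<le> (real k + 1) * real (num_divisors m)"
        using num_divisors_prime_power[OF p(1), of k] by (intro mult_right_mono) linarith+
      also have "\<dots> \<le> (w * real (p ^ k) powr \<epsilon>) * (K ^ card {p\<in>S. p dvd m} * real m powr \<epsilon>)"
        using less.IH[OF \<open>m < n\<close> \<open>0 < m\<close>] w K by (intro mult_mono) (auto simp: w_def)
      also have "\<dots> = K ^ card {p\<in>S. p dvd n} * real n powr \<epsilon>"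
        by (subst cd, simp only: m(1) of_nat_mult) (simp add: powr_mult)
      finally show ?thesis .
    qed
  qed
  show ?thesis
  proof (intro exI[of _ "K ^ card S"] conjI allI impI)
    fix n :: nat assume "0 < n"
    have "K ^ card {p\<in>S. p dvd n} \<le> K ^ card S" using K fS by (intro power_increasing card_mono) auto
    then show "real (num_divisors n) \<le> K ^ card S * real n powr \<epsilon>"
      by (intro order_trans[OF main[OF \<open>0 < n\<close>]] mult_right_mono) auto
  qed (use K in auto)
qed

section \<open>Fourier analysis modulo \<open>q\<close>\<close>

definition fourier :: "nat \<Rightarrow> (int \<Rightarrow> real) \<Rightarrow> real \<Rightarrow> complex" where
  "fourier n f \<alpha> = (\<Sum>x\<in>window n. of_real (f x) * cis (2 * pi * \<alpha> * x))"

lemma fourier_join: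
  assumes f: "\<And>x. x \<notin> window n \<Longrightarrow> f x = 0"
  shows "fourier (n + m) (join n m f g) \<alpha> = fourier n f \<alpha> * fourier m g (2 ^ n * \<alpha>)"
proof -
  have "fourier (n + m) (join n m f g) \<alpha> = (\<Sum>z\<in>window m. \<Sum>y\<in>window n.
      of_real (g z) * of_real (f y) * cis (2 * pi * \<alpha> * (y + 2 ^ n * z)))"
    unfolding fourier_def by (subst sum_join[OF f]) auto
  also have "\<dots> = (\<Sum>z\<in>window m. \<Sum>y\<in>window n.
      (of_real (g z) * cis (2 * pi * (2 ^ n * \<alpha>) * z)) * (of_real (f y) * cis (2 * pi * \<alpha> * y)))"
    by (intro sum.cong refl) (simp add: cis_mult algebra_simps)
  also have "\<dots> = fourier n f \<alpha> * fourier m g (2 ^ n * \<alpha>)"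
    unfolding fourier_def sum_product[symmetric] by (rule mult.commute)
  finally show ?thesis .
qed

lemma norm_fourier_le: "(\<And>x. 0 \<le> f x) \<Longrightarrow> norm (fourier n f \<alpha>) \<le> (\<Sum>x\<in>window n. f x)"
  unfolding fourier_def by (rule order_trans[OF norm_sum]) (simp add: norm_mult)

lemma norm_fourier_diff_le:
  "norm (fourier n f \<alpha> - fourier n g \<alpha>) \<le> (\<Sum>x\<in>window n. \<bar>f x - g x\<bar>)"
proof -
  have "fourier n f \<alpha> - fourier n g \<alpha> = (\<Sum>x\<in>window n. of_real (f x - g x) * cis (2 * pi * \<alpha> * x))"
    by (simp add: fourier_def sum_subtractf[symmetric] algebra_simps)
  then show ?thesis by (simp only:) (rule order_trans[OF norm_sum], simp add: norm_mult del: of_real_diff)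
qed

lemma sum_cis_root:
  fixes z :: int
  assumes q: "q > 0"
  shows "(\<Sum>\<xi><q. cis (2 * pi * (real \<xi> / real q) * z)) = (if int q dvd z then of_nat q else 0)"
proof -
  define w where "w = cis (2 * pi * z / q)"
  have pw: "cis (2 * pi * (real \<xi> / real q) * z) = w ^ \<xi>" for \<xi>
  proof -
    have "2 * pi * (real \<xi> / real q) * z = real \<xi> * (2 * pi * z / q)" by simp
    then show ?thesis by (simp only: w_def Complex.DeMoivre)
  qed
  have wq: "w ^ q = 1"
  proof -
    have "real q * (2 * pi * z / q) = 2 * pi * z" using q by simp
    then show ?thesis by (simp only: w_def Complex.DeMoivre cis_multiple_2pi Ints_of_int)
  qed
  have w1: "w = 1 \<longleftrightarrow> int q dvd z"
  proof
    assume "w = 1"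
    then have "cos (2 * pi * z / q) = 1" by (simp add: w_def complex_eq_iff)
    then obtain k :: int where "2 * pi * z / q = k * 2 * pi" by (auto simp: cos_one_2pi_int)
    then have "real_of_int z = k * q" using q by (simp add: field_simps)
    then have "z = k * int q" by (metis of_int_eq_iff of_int_mult of_int_of_nat_eq)
    then show "int q dvd z" by simp
  next
    assume "int q dvd z"
    then obtain k where "z = int q * k" by (auto elim: dvdE)
    then have "2 * pi * z / q = 2 * pi * k" using q by simp
    then show "w = 1" by (simp add: w_def cis_multiple_2pi)
  qed
  show ?thesis
    unfolding pw using wq w1 by (auto simp: sum_gp_strict)
qed

lemma parseval_mod:
  assumes q: "q > 0"
  shows "(\<Sum>\<xi><q. (norm (fourier n f (real \<xi> / real q)))\<^sup>2)
    = real q * (\<Sum>x\<in>window n. \<Sum>y\<in>window n. if int q dvd x - y then f x * f y else 0)"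
proof -
  have "complex_of_real ((norm (fourier n f (real \<xi> / real q)))\<^sup>2) =
    (\<Sum>x\<in>window n. \<Sum>y\<in>window n. of_real (f x * f y) * cis (2 * pi * (real \<xi> / real q) * of_int (x - y)))" for \<xi>
  proof -
    have "complex_of_real ((norm (fourier n f (real \<xi> / real q)))\<^sup>2)
      = fourier n f (real \<xi> / real q) * cnj (fourier n f (real \<xi> / real q))"
      by (rule complex_norm_square)
    also have "\<dots> = (\<Sum>x\<in>window n. \<Sum>y\<in>window n. of_real (f x * f y) * cis (2 * pi * (real \<xi> / real q) * of_int (x - y)))"
      unfolding fourier_def cnj_sum sum_product
      by (intro sum.cong refl) (simp add: cis_cnj cis_mult algebra_simps diff_divide_distrib)
    finally show ?thesis .
  qed
  then have "complex_of_real (\<Sum>\<xi><q. (norm (fourier n f (real \<xi> / real q)))\<^sup>2)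
    = (\<Sum>\<xi><q. \<Sum>x\<in>window n. \<Sum>y\<in>window n. of_real (f x * f y) * cis (2 * pi * (real \<xi> / real q) * of_int (x - y)))"
    by (simp only: of_real_sum)
  also have "\<dots> = (\<Sum>x\<in>window n. \<Sum>y\<in>window n. of_real (f x * f y) * (\<Sum>\<xi><q. cis (2 * pi * (real \<xi> / real q) * of_int (x - y))))"
    by (subst sum.swap, rule sum.cong[OF refl], subst sum.swap, simp only: sum_distrib_left)
  also have "\<dots> = complex_of_real (real q * (\<Sum>x\<in>window n. \<Sum>y\<in>window n. if int q dvd x - y then f x * f y else 0))"
    unfolding sum_cis_root[OF q] by (simp add: sum_distrib_left mult_ac if_distrib cong: if_cong)
  finally show ?thesis by (simp only: of_real_eq_iff)
qed

definition fold_mod :: "nat \<Rightarrow> nat \<Rightarrow> (int \<Rightarrow> real) \<Rightarrow> int \<Rightarrow> real" where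
  "fold_mod q n f r = (\<Sum>x\<in>window n. if x mod int q = r then f x else 0)"

lemma residues_mod_finite [simp]: "finite (residues_mod q)" by (simp add: residues_mod_def)

lemma card_residues_mod: "card (residues_mod q) = q" by (simp add: residues_mod_def)

lemma sum_fold_mod:
  assumes q: "q > 0"
  shows "(\<Sum>r\<in>residues_mod q. fold_mod q n f r * g r) = (\<Sum>x\<in>window n. f x * g (x mod int q))"
proof -
  have "(\<Sum>r\<in>residues_mod q. fold_mod q n f r * g r)
    = (\<Sum>r\<in>residues_mod q. \<Sum>x\<in>window n. if r = x mod int q then f x * g r else 0)"
    by (auto simp: fold_mod_def sum_distrib_right intro!: sum.cong)
  also have "\<dots> = (\<Sum>x\<in>window n. \<Sum>r\<in>residues_mod q. if r = x mod int q then f x * g r else 0)"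
    by (rule sum.swap)
  also have "\<dots> = (\<Sum>x\<in>window n. f x * g (x mod int q))"
    using q by (intro sum.cong refl) (simp add: residues_mod_def)
  finally show ?thesis .
qed

text \<open>Cauchy-Schwarz and Parseval; removing the mean removes the frequency 0.\<close>

lemma fold_mod_l1_le:
  assumes q: "q > 0"
  shows "(\<Sum>r\<in>residues_mod q. \<bar>fold_mod q n f r - (\<Sum>x\<in>window n. f x) / q\<bar>)
    \<le> sqrt (\<Sum>\<xi>\<in>{1..<q}. (norm (fourier n f (real \<xi> / real q)))\<^sup>2)"
proof -
  define m where "m = (\<Sum>x\<in>window n. f x)"
  let ?F = "fold_mod q n f" and ?S = "\<Sum>\<xi>\<in>{1..<q}. (norm (fourier n f (real \<xi> / real q)))\<^sup>2"
  have sF: "(\<Sum>r\<in>residues_mod q. ?F r) = m"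
    using sum_fold_mod[OF q, of n f "\<lambda>_. 1"] by (simp add: m_def)
  have "(\<Sum>r\<in>residues_mod q. (?F r)\<^sup>2) = (\<Sum>x\<in>window n. f x * ?F (x mod int q))"
    using sum_fold_mod[OF q, of n f ?F] by (simp add: power2_eq_square)
  also have "\<dots> = (\<Sum>x\<in>window n. \<Sum>y\<in>window n. if int q dvd x - y then f x * f y else 0)"
    unfolding fold_mod_def sum_distrib_left
    by (intro sum.cong refl) (auto simp: mod_eq_dvd_iff dvd_diff_commute)
  finally have sq: "real q * (\<Sum>r\<in>residues_mod q. (?F r)\<^sup>2) = (\<Sum>\<xi><q. (norm (fourier n f (real \<xi> / real q)))\<^sup>2)"
    using parseval_mod[OF q, of n f] by simp
  have "{..<q} = insert 0 {1..<q}" using q by auto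
  then have "(\<Sum>\<xi><q. (norm (fourier n f (real \<xi> / real q)))\<^sup>2) = (norm (fourier n f 0))\<^sup>2 + ?S"
    by simp
  also have "fourier n f 0 = of_real m" by (simp add: fourier_def m_def)
  finally have S: "real q * (\<Sum>r\<in>residues_mod q. (?F r)\<^sup>2) = m\<^sup>2 + ?S" using sq by simp
  have "(\<Sum>r\<in>residues_mod q. (?F r - m / q)\<^sup>2)
     = (\<Sum>r\<in>residues_mod q. (?F r)\<^sup>2) - 2 * (m / q) * (\<Sum>r\<in>residues_mod q. ?F r) + q * (m / q)\<^sup>2"
    by (simp add: power2_diff sum.distrib sum_subtractf sum_distrib_left sum_divide_distrib card_residues_mod mult_ac)
  then have V: "real q * (\<Sum>r\<in>residues_mod q. (?F r - m / q)\<^sup>2) = ?S"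
    using S q unfolding sF by (simp add: field_simps power2_eq_square)
  have "(\<Sum>r\<in>residues_mod q. \<bar>?F r - m / q\<bar> * 1)
    \<le> L2_set (\<lambda>r. ?F r - m / q) (residues_mod q) * L2_set (\<lambda>_. 1) (residues_mod q)"
    using L2_set_mult_ineq[of "\<lambda>r. ?F r - m / q" "\<lambda>_. 1"] by simp
  also have "\<dots> = sqrt (real q * (\<Sum>r\<in>residues_mod q. (?F r - m / q)\<^sup>2))"
    by (simp add: L2_set_def card_residues_mod real_sqrt_mult mult.commute)
  finally have "(\<Sum>r\<in>residues_mod q. \<bar>?F r - m / q\<bar>) \<le> sqrt ?S" unfolding V by simp
  then show ?thesis by (simp add: m_def)
qed

lemma walk_dist_eq:
  assumes q: "q > 0"
  shows "walk_dist 2 steps q n = (\<Sum>r\<in>residues_mod q. \<bar>fold_mod q n (law n) r - 1 / q\<bar>)"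
proof -
  have "pmf (mod_law q (walk_law 2 steps n)) r = fold_mod q n (law n) r" for r
  proof -
    have "pmf (mod_law q (walk_law 2 steps n)) r = measure_pmf.prob (walk_law 2 steps n) {x. x mod int q = r}"
      by (simp add: mod_law_def pmf_map vimage_def)
    also have "\<dots> = measure_pmf.prob (walk_law 2 steps n) ({x. x mod int q = r} \<inter> window n)"
      by (intro measure_eq_AE) (use set_walk_law[of n] in \<open>auto simp: AE_measure_pmf_iff\<close>)
    also have "\<dots> = (\<Sum>x\<in>{x. x mod int q = r} \<inter> window n. law n x)"
      by (subst measure_measure_pmf_finite) (auto simp: law_def)
    also have "\<dots> = fold_mod q n (law n) r"
      unfolding fold_mod_def by (subst sum.inter_filter[symmetric]) (auto intro!: sum.cong)
    finally show ?thesis .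
  qed
  moreover have "pmf (uniform_mod q) r = 1 / q" if "r \<in> residues_mod q" for r
    unfolding uniform_mod_def using that by (subst pmf_of_set) (auto simp: card_residues_mod)
  ultimately show ?thesis by (simp add: walk_dist_def l1_norm_mod_def)
qed

text \<open>The lost mass is paid twice, once for passing from the law to \<open>f\<close> and once because the mean of \<open>f\<close>
  modulo \<open>q\<close> is smaller than \<open>1 / q\<close>.\<close>

lemma walk_dist_le_fourier:
  assumes q: "q > 0" and f: "\<And>x. f x \<le> law n x"
  shows "walk_dist 2 steps q n \<le> 2 * (1 - (\<Sum>x\<in>window n. f x))
    + sqrt (\<Sum>\<xi>\<in>{1..<q}. (norm (fourier n f (real \<xi> / real q)))\<^sup>2)"
proof -
  define m where "m = (\<Sum>x\<in>window n. f x)"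
  have m: "m \<le> 1" unfolding m_def sum_law[of n, symmetric] by (intro sum_mono f)
  have le: "fold_mod q n f r \<le> fold_mod q n (law n) r" for r
    unfolding fold_mod_def using f by (intro sum_mono) auto
  have "walk_dist 2 steps q n \<le> (\<Sum>r\<in>residues_mod q. (fold_mod q n (law n) r - fold_mod q n f r)
      + \<bar>fold_mod q n f r - m / q\<bar> + (1 - m) / q)"
    unfolding walk_dist_eq[OF q]
  proof (intro sum_mono)
    fix r
    have "0 \<le> (1 - m) / q" using m by simp
    then show "\<bar>fold_mod q n (law n) r - 1 / q\<bar> \<le> (fold_mod q n (law n) r - fold_mod q n f r)
      + \<bar>fold_mod q n f r - m / q\<bar> + (1 - m) / q"
      using le[of r] unfolding diff_divide_distrib by arith
  qed
  also have "\<dots> = (1 - m) + (\<Sum>r\<in>residues_mod q. \<bar>fold_mod q n f r - m / q\<bar>) + (1 - m)"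
    using q sum_fold_mod[OF q, of n f "\<lambda>_. 1"] sum_fold_mod[OF q, of n "law n" "\<lambda>_. 1"]
    by (simp add: sum.distrib sum_subtractf m_def sum_law card_residues_mod)
  finally show ?thesis using fold_mod_l1_le[OF q, of n f] by (simp add: m_def)
qed

text \<open>By Parseval the sum counts collisions modulo \<open>q\<close> of two independent samples. Either the samples are
  equal, which has probability at most \<open>s\<close>, or \<open>q\<close> is one of the at most \<open>D\<close> divisors of their difference.\<close>

lemma sum_fourier_sq_le:
  assumes f: "\<And>x. 0 \<le> f x" "\<And>x. f x \<le> s" "(\<Sum>x\<in>window n. f x) \<le> 1"
    and dv: "\<And>z. 0 < z \<Longrightarrow> z < 2 ^ (n + 1) \<Longrightarrow> real (num_divisors z) \<le> D"
  shows "(\<Sum>q\<in>{1..Q}. \<Sum>\<xi><q. (norm (fourier n f (real \<xi> / real q)))\<^sup>2) \<le> real Q * (real Q * s + D)"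
proof -
  have s0: "0 \<le> s" using f(1)[of 0] f(2)[of 0] by linarith
  have "real (num_divisors 1) \<le> D" 
    by (rule dv) (use one_less_power[of "2::nat" "n + 1"] in simp_all)
  then have D0: "0 \<le> D" by linarith
  let ?c = "\<lambda>x y. real (card {q. q \<in> {1..Q} \<and> int q dvd x - y})"
  have c: "?c x y * f y \<le> Q * (if x = y then s else 0) + D * f y"
    if "x \<in> window n" "y \<in> window n" for x y
  proof (cases "x = y")
    case True
    have "card {q. q \<in> {1..Q} \<and> int q dvd x - y} \<le> card {1..Q}" by (intro card_mono) auto
    then have "?c x y * f y \<le> Q * s" using f by (intro mult_mono) auto
    also have "\<dots> \<le> Q * (if x = y then s else 0) + D * f y" using True D0 f by simp
    finally show ?thesis .
  next
    case False
    have z: "0 < nat \<bar>x - y\<bar>" "nat \<bar>x - y\<bar> < 2 ^ (n + 1)" using that False by (auto simp: window_def nat_less_iff)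
    have "card {q. q \<in> {1..Q} \<and> int q dvd x - y} \<le> num_divisors (nat \<bar>x - y\<bar>)"
      unfolding num_divisors_def
      by (intro card_mono finite_divisors_nat) (use z in \<open>auto simp: nat_dvd_iff int_dvd_int_iff[symmetric]\<close>)
    then have "?c x y \<le> D" using dv[OF z] by linarith
    then show ?thesis using False f by (simp add: mult_right_mono)
  qed
  have "(\<Sum>q\<in>{1..Q}. \<Sum>\<xi><q. (norm (fourier n f (real \<xi> / real q)))\<^sup>2)
    = (\<Sum>q\<in>{1..Q}. real q * (\<Sum>x\<in>window n. \<Sum>y\<in>window n. if int q dvd x - y then f x * f y else 0))"
    by (intro sum.cong refl parseval_mod) auto
  also have "\<dots> \<le> (\<Sum>q\<in>{1..Q}. real Q * (\<Sum>x\<in>window n. \<Sum>y\<in>window n. if int q dvd x - y then f x * f y else 0))"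
    by (intro sum_mono mult_right_mono sum_nonneg) (use f in auto)
  also have "\<dots> = real Q * (\<Sum>x\<in>window n. \<Sum>y\<in>window n. \<Sum>q\<in>{1..Q}. if int q dvd x - y then f x * f y else 0)"
    unfolding sum_distrib_left[symmetric]
    by (subst sum.swap, rule arg_cong[where f = "(*) (real Q)"], rule sum.cong[OF refl], rule sum.swap)
  also have "\<dots> = real Q * (\<Sum>x\<in>window n. f x * (\<Sum>y\<in>window n. ?c x y * f y))"
  proof -
    have "(\<Sum>q\<in>{1..Q}. if int q dvd x - y then f x * f y else 0) = f x * (?c x y * f y)" for x y
      by (simp add: sum.If_cases Int_def)
    then show ?thesis by (simp only: sum_distrib_left)
  qed
  also have "\<dots> \<le> real Q * (\<Sum>x\<in>window n. f x * (\<Sum>y\<in>window n. Q * (if x = y then s else 0) + D * f y))"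
    by (intro mult_left_mono sum_mono c f) auto
  also have "\<dots> = real Q * (\<Sum>x\<in>window n. f x * (Q * s + D * (\<Sum>y\<in>window n. f y)))"
    by (intro arg_cong[where f = "(*) (real Q)"] sum.cong refl)
      (simp add: sum.distrib sum_distrib_left[symmetric])
  also have "\<dots> = real Q * ((\<Sum>x\<in>window n. f x) * (Q * s + D * (\<Sum>y\<in>window n. f y)))"
    by (simp add: sum_distrib_right)
  also have "\<dots> \<le> real Q * (1 * (Q * s + D * 1))"
    by (intro mult_left_mono mult_mono add_left_mono) (use f s0 D0 in \<open>auto intro!: sum_nonneg add_nonneg_nonneg mult_nonneg_nonneg\<close>)
  finally show ?thesis by simp
qed

section \<open>Entropy and the weights of atoms\<close>

text \<open>Fekete's lemma.\<close>

lemma subadditive_limit: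
  fixes h :: "nat \<Rightarrow> real"
  assumes sub: "\<And>m n. h (m + n) \<le> h m + h n" and nonneg: "\<And>n. 0 \<le> h n"
  shows "convergent (\<lambda>n. h n / real n)"
proof -
  define L where "L = (INF n\<in>{1..}. h n / real n)"
  have bdd: "bdd_below ((\<lambda>n. h n / real n) ` {1..})"
    using nonneg by (intro bdd_belowI[of _ 0]) auto
  have mult: "h (k * a) \<le> real k * h a + h 0" for k a
  proof (induction k)
    case (Suc k)
    have "h (Suc k * a) \<le> h a + h (k * a)" using sub[of a "k * a"] by simp
    then show ?case using Suc by (simp add: algebra_simps)
  qed simp
  have "(\<lambda>n. h n / real n) \<longlonglongrightarrow> L"
  proof (rule order_tendstoI)
    fix c assume "c < L"
    have "c < h n / real n" if "1 \<le> n" for n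
      using cINF_lower[OF bdd, of n] that \<open>c < L\<close> by (simp add: L_def)
    then show "\<forall>\<^sub>F n in sequentially. c < h n / real n"
      by (auto simp: eventually_sequentially)
  next
    fix c assume "L < c"
    then obtain a where a: "1 \<le> a" "h a / real a < c"
      using cInf_lessD[of "(\<lambda>n. h n / real n) ` {1..}" c] by (auto simp: L_def)
    define C where "C = Max (h ` {..<a}) + h 0"
    have le: "h n \<le> real n * (h a / a) + C" for n
    proof -
      have "h n \<le> h (n div a * a) + h (n mod a)" using sub[of "n div a * a" "n mod a"] by simp
      also have "h (n mod a) \<le> Max (h ` {..<a})" using a by (intro Max_ge) auto
      also have "h (n div a * a) \<le> real (n div a) * h a + h 0" by (rule mult)
      also have "real (n div a) * h a \<le> (real n / real a) * h a"
        by (intro mult_right_mono of_nat_div_le_of_nat nonneg)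
      finally show ?thesis by (simp add: C_def)
    qed
    have "(\<lambda>n. h a / a + C / real n) \<longlonglongrightarrow> h a / a + 0"
      by (intro tendsto_intros lim_const_over_n)
    then have "\<forall>\<^sub>F n in sequentially. h a / a + C / real n < c"
      using a by (auto dest: order_tendstoD(2))
    then show "\<forall>\<^sub>F n in sequentially. h n / real n < c"
      using eventually_gt_at_top[of 0]
    proof eventually_elim
      case (elim n)
      have "h n / real n \<le> (real n * (h a / a) + C) / real n" by (intro divide_right_mono le) simp
      also have "\<dots> = h a / a + C / real n" using elim by (simp add: field_simps)
      finally show ?case using elim by simp
    qed
  qed
  then show ?thesis by (rule convergentI)
qed

definition ent :: "nat \<Rightarrow> real" where "ent n = entropy_pmf (walk_law 2 steps n)"

lemma ent_eq: "ent n = (\<Sum>x\<in>window n. law n x * - ln (law n x))"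
proof -
  have "ent n = (\<Sum>x\<in>set_pmf (walk_law 2 steps n). law n x * - ln (law n x))"
    unfolding ent_def entropy_pmf_def law_def
    by (intro sum.cong refl) (simp add: ln_div pmf_positive_iff[symmetric] set_pmf_iff)
  also have "\<dots> = (\<Sum>x\<in>window n. law n x * - ln (law n x))"
    by (intro sum.mono_neutral_left set_walk_law) (auto simp: law_def set_pmf_iff)
  finally show ?thesis .
qed

lemma ent_nonneg: "0 \<le> ent n"
proof -
  have "ln (law n x) \<le> 0" for x
    by (cases "law n x = 0") (simp_all add: law_le_1 less_le)
  then show ?thesis unfolding ent_eq by (intro sum_nonneg mult_nonneg_nonneg) auto
qed

lemma join_law_ge: "y \<in> window n \<Longrightarrow> z \<in> window m \<Longrightarrow> law m z * law n y \<le> law (n + m) (y + 2 ^ n * z)"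
proof -
  assume "z \<in> window m"
  then have "law m z * law n (y + 2 ^ n * z - 2 ^ n * z)
    \<le> (\<Sum>z'\<in>window m. law m z' * law n (y + 2 ^ n * z - 2 ^ n * z'))"
    by (intro member_le_sum) auto
  then show ?thesis by (simp add: law_add join_def)
qed

text \<open>The pair of low and high digits determines the sum, so by \<open>join_law_ge\<close> the information content of the sum
  is at most the sum of the two information contents.\<close>

lemma ent_add: "ent (n + m) \<le> ent n + ent m"
proof -
  have "ent (n + m) = (\<Sum>x\<in>window (n + m). of_real (join n m (law n) (law m) x) * - ln (law (n + m) x))"
    by (simp add: ent_eq flip: law_add)
  also have "\<dots> = (\<Sum>z\<in>window m. \<Sum>y\<in>window n. law m z * law n y * - ln (law (n + m) (y + 2 ^ n * z)))"
    by (subst sum_join) (auto simp: law_outside)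
  also have "\<dots> \<le> (\<Sum>z\<in>window m. \<Sum>y\<in>window n. law m z * law n y * (- ln (law m z) - ln (law n y)))"
  proof (intro sum_mono)
    fix z y assume zy: "z \<in> window m" "y \<in> window n"
    show "law m z * law n y * - ln (law (n + m) (y + 2 ^ n * z)) \<le> law m z * law n y * (- ln (law m z) - ln (law n y))"
    proof (cases "law m z = 0 \<or> law n y = 0")
      case False
      then have p: "0 < law m z" "0 < law n y" by (auto simp: less_le)
      then have "ln (law m z * law n y) \<le> ln (law (n + m) (y + 2 ^ n * z))"
        using join_law_ge[OF zy(2,1)] by (intro ln_mono) (auto intro: mult_pos_pos)
      then show ?thesis using p by (intro mult_left_mono) (auto simp: ln_mult)
    qed auto
  qed
  also have "\<dots> = (\<Sum>z\<in>window m. law m z * - ln (law m z)) * (\<Sum>y\<in>window n. law n y)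
      + (\<Sum>z\<in>window m. law m z) * (\<Sum>y\<in>window n. law n y * - ln (law n y))"
    by (simp only: sum_product sum.distrib[symmetric]) (intro sum.cong refl, simp add: algebra_simps)
  also have "\<dots> = ent n + ent m" by (simp add: sum_law ent_eq)
  finally show ?thesis .
qed

lemma ent_limit: "(\<lambda>n. ent n / real n) \<longlonglongrightarrow> asymptotic_entropy 2 steps"
  using subadditive_limit[of ent, OF ent_add ent_nonneg]
  unfolding convergent_LIMSEQ_iff asymptotic_entropy_def ent_def .

text \<open>The exponential moments of the information content. They start from 1 at \<open>t = 1\<close> with slope minus the
  entropy, so that Markov's inequality for them gives large deviation bounds with the entropy as threshold.\<close>

definition power_sum :: "real \<Rightarrow> nat \<Rightarrow> real" where
  "power_sum t n = (\<Sum>x\<in>window n. law n x powr t)"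

lemma power_sum_nonneg: "0 \<le> power_sum t n"
  unfolding power_sum_def by (intro sum_nonneg) simp

lemma power_sum_0: "power_sum t 0 = 1"
proof -
  have "window 0 = {0}" by (auto simp: window_def)
  then show ?thesis by (simp add: power_sum_def law_0)
qed

lemma power_sum_deriv: "((\<lambda>t. power_sum t n) has_real_derivative - ent n) (at 1)"
proof -
  have "((\<lambda>t. law n x powr t) has_real_derivative law n x * ln (law n x)) (at 1)" for x
  proof (cases "law n x = 0")
    case False
    then have "0 < law n x" by (simp add: less_le)
    then show ?thesis by (auto intro!: derivative_eq_intros)
  qed simp
  then have "((\<lambda>t. power_sum t n) has_real_derivative (\<Sum>x\<in>window n. law n x * ln (law n x))) (at 1)"
    unfolding power_sum_def by (intro DERIV_sum)
  then show ?thesis by (simp add: ent_eq sum_negf)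
qed

lemma power_sum_1: "power_sum 1 n = 1"
  by (simp add: power_sum_def sum_law)

lemma sum_join_self:
  assumes g: "\<And>x. x \<notin> window n \<Longrightarrow> f x = 0"
  shows "(\<Sum>x\<in>window (n + m). join n m f g x) = (\<Sum>z\<in>window m. g z) * (\<Sum>y\<in>window n. f y)"
  using sum_join[where F = "\<lambda>_. 1 :: real", OF g] by (simp add: sum_product)

lemma powr_sum_le:
  fixes a b :: real
  assumes "0 \<le> a" "0 \<le> b" "0 < t" "t \<le> 1"
  shows "(a + b) powr t \<le> a powr t + b powr t"
proof (cases "a + b = 0")
  case False
  then have ab: "0 < a + b" using assms by linarith
  have *: "x / (a + b) \<le> (x / (a + b)) powr t" if "0 \<le> x" "x \<le> a + b" for x
    using powr_mono'[of t 1 "x / (a + b)"] that ab assms by simp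
  have "1 = a / (a + b) + b / (a + b)" using ab by (simp add: add_divide_distrib[symmetric])
  also have "\<dots> \<le> (a / (a + b)) powr t + (b / (a + b)) powr t"
    using assms by (intro add_mono *) auto
  also have "\<dots> = (a powr t + b powr t) / (a + b) powr t"
    using assms ab by (simp add: powr_divide add_divide_distrib)
  finally show ?thesis using ab by (simp add: field_simps)
qed (use assms in auto)

lemma powr_sum_ge:
  fixes a b :: real
  assumes "0 \<le> a" "0 \<le> b" "0 < s"
  shows "(a + b) powr (1 + s) \<le> 2 powr s * (a powr (1 + s) + b powr (1 + s))"
proof (cases "a = 0 \<or> b = 0")
  case True
  have "1 \<le> 2 powr s" using assms by (simp add: ge_one_powr_ge_zero)
  then have "1 * x \<le> 2 powr s * x" if "0 \<le> x" for x :: real using that by (rule mult_right_mono)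
  from this[of "a powr (1 + s)"] this[of "b powr (1 + s)"] show ?thesis using True assms by auto
next
  case False
  then have ab: "0 < a" "0 < b" using assms by auto
  have "((1 - 1/2) *\<^sub>R a + (1/2) *\<^sub>R b) powr (1 + s) \<le> (1 - 1/2) * a powr (1 + s) + (1/2) * b powr (1 + s)"
    using powr_convex[of "1 + s"] assms ab by (intro convex_onD[of "{0<..}" "\<lambda>x. x powr (1 + s)"]) auto
  also have "(1 - 1/2) *\<^sub>R a + (1/2) *\<^sub>R b = (a + b) / 2" by (simp add: add_divide_distrib)
  also have "((a + b) / 2) powr (1 + s) = (a + b) powr (1 + s) / (2 * 2 powr s)"
    using ab by (subst powr_divide) (auto simp: powr_add)
  finally have "(a + b) powr (1 + s) \<le> ((1 - 1/2) * a powr (1 + s) + (1/2) * b powr (1 + s)) * (2 * 2 powr s)"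
    by (simp add: pos_divide_le_eq)
  also have "\<dots> = 2 powr s * (a powr (1 + s) + b powr (1 + s))" by (simp add: algebra_simps)
  finally show ?thesis .
qed

lemma join_powr_le:
  assumes f: "\<And>x. x \<notin> window n \<Longrightarrow> f x = 0" "\<And>x. 0 \<le> f x"
    and g: "\<And>x. x \<notin> window m \<Longrightarrow> g x = 0" "\<And>x. 0 \<le> g x"
    and c: "\<And>a b :: real. 0 \<le> a \<Longrightarrow> 0 \<le> b \<Longrightarrow> (a + b) powr t \<le> c * (a powr t + b powr t)"
  shows "join n m f g x powr t \<le> c * join n m (\<lambda>x. f x powr t) (\<lambda>x. g x powr t) x"
proof -
  have "join n m (\<lambda>x. f x powr t) (\<lambda>x. g x powr t) x =
    (g (x div 2 ^ n) * f (x mod 2 ^ n)) powr t + (g (x div 2 ^ n + 1) * f (x mod 2 ^ n - 2 ^ n)) powr t"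
    using f g by (subst join_two_terms) (auto simp: powr_mult)
  moreover have "join n m f g x = g (x div 2 ^ n) * f (x mod 2 ^ n) + g (x div 2 ^ n + 1) * f (x mod 2 ^ n - 2 ^ n)"
    using f g by (intro join_two_terms) auto
  ultimately show ?thesis using c f g by simp
qed

lemma power_sum_add_le:
  assumes c: "\<And>a b :: real. 0 \<le> a \<Longrightarrow> 0 \<le> b \<Longrightarrow> (a + b) powr t \<le> c * (a powr t + b powr t)"
  shows "power_sum t (n + m) \<le> c * (power_sum t n * power_sum t m)"
proof -
  have "power_sum t (n + m) \<le> (\<Sum>x\<in>window (n + m). c * join n m (\<lambda>x. law n x powr t) (\<lambda>x. law m x powr t) x)"
    unfolding power_sum_def law_add by (intro sum_mono join_powr_le c) (auto simp: law_outside)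
  also have "\<dots> = c * (power_sum t n * power_sum t m)"
    unfolding sum_distrib_left[symmetric] power_sum_def
    by (subst sum_join_self) (auto simp: law_outside)
  finally show ?thesis .
qed

lemma power_sum_mult_le:
  assumes c: "\<And>a b :: real. 0 \<le> a \<Longrightarrow> 0 \<le> b \<Longrightarrow> (a + b) powr t \<le> c * (a powr t + b powr t)" and "0 \<le> c"
  shows "power_sum t (l * k) \<le> (c * power_sum t k) ^ l"
proof (induction l)
  case (Suc l)
  have "power_sum t (Suc l * k) \<le> c * (power_sum t k * power_sum t (l * k))"
    using power_sum_add_le[of t c k "l * k", OF c] by simp
  also have "\<dots> \<le> c * (power_sum t k * (c * power_sum t k) ^ l)"
    using Suc \<open>0 \<le> c\<close> by (intro mult_left_mono) (auto simp: power_sum_nonneg)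
  finally show ?case by (simp add: mult_ac)
qed (simp add: power_sum_0)

lemma dip_below_one:
  fixes \<phi> :: "real \<Rightarrow> real"
  assumes "(\<phi> has_real_derivative d) (at 0)" "d < 0" "\<phi> 0 = 1" "0 < e"
  shows "\<exists>s. 0 < s \<and> s < e \<and> \<phi> s < 1"
proof -
  obtain d' where "0 < d'" "\<And>h. 0 < h \<Longrightarrow> h < d' \<Longrightarrow> \<phi> (0 + h) < \<phi> 0"
    using DERIV_neg_dec_right[OF assms(1,2)] by blast
  then show ?thesis using assms(3,4) by (intro exI[of _ "min d' e / 2"]) (auto simp: min_def)
qed

text \<open>Markov's inequality for the power \<open>1 + s\<close> with small \<open>s > 0\<close>. The two terms of \<open>join_two_terms\<close> cost
  a factor \<open>2^s\<close> for each piece of \<open>k\<close> digits, which acts like a loss of \<open>ln 2 / k\<close> in the entropy; this is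
  why the estimate is for multiples of a large \<open>k\<close>.\<close>

lemma heavy_atoms_rare:
  assumes h: "h < asymptotic_entropy 2 steps"
  shows "\<exists>k \<beta>. 0 < k \<and> 0 < \<beta> \<and> \<beta> < 1 \<and>
    (\<forall>l. (\<Sum>x\<in>{x\<in>window (l * k). exp (- h * (l * k)) < law (l * k) x}. law (l * k) x) \<le> \<beta> ^ l)"
proof -
  have "(\<lambda>n. ent n / real n - ln 2 / real n) \<longlonglongrightarrow> asymptotic_entropy 2 steps - 0"
    by (intro tendsto_diff ent_limit lim_const_over_n)
  then have "\<forall>\<^sub>F k in sequentially. h < ent k / real k - ln 2 / real k"
    using h by (auto dest: order_tendstoD(1))
  then obtain k where k: "0 < k" "h < ent k / real k - ln 2 / real k"
    using eventually_happens'[OF sequentially_bot eventually_conj[OF _ eventually_gt_at_top[of "0::nat"]]] by blast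
  then have neg: "h * k + ln 2 - ent k < 0" by (simp add: field_simps)
  have "((\<lambda>s. power_sum (1 + s) k) has_real_derivative - ent k * 1) (at 0)"
    by (rule DERIV_chain2) (use power_sum_deriv in \<open>auto intro!: derivative_eq_intros\<close>)
  moreover have "((\<lambda>s. exp (s * (h * k)) * 2 powr s) has_real_derivative h * k + ln 2) (at 0)"
    by (auto intro!: derivative_eq_intros)
  ultimately have "((\<lambda>s. (exp (s * (h * k)) * 2 powr s) * power_sum (1 + s) k) has_real_derivative
      (h * k + ln 2) * power_sum (1 + 0) k + (- ent k * 1) * (exp (0 * (h * k)) * 2 powr 0)) (at 0)"
    by (intro DERIV_mult)
  then have "((\<lambda>s. exp (s * (h * k)) * (2 powr s * power_sum (1 + s) k)) has_real_derivative h * k + ln 2 - ent k) (at 0)"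
    by (simp add: power_sum_1 mult.assoc)
  from dip_below_one[OF this neg _ zero_less_one]
  obtain s where s: "0 < s" "exp (s * (h * k)) * (2 powr s * power_sum (1 + s) k) < 1"
    by (auto simp: power_sum_1)
  define \<beta>0 where "\<beta>0 = exp (s * (h * k)) * (2 powr s * power_sum (1 + s) k)"
  define \<beta> where "\<beta> = max \<beta>0 (1 / 2)"
  have \<beta>0: "0 \<le> \<beta>0" "\<beta>0 \<le> \<beta>" by (auto simp: \<beta>0_def \<beta>_def power_sum_nonneg)
  have "0 < \<beta>" "\<beta> < 1" using s by (auto simp: \<beta>_def \<beta>0_def)
  moreover have "(\<Sum>x\<in>{x\<in>window (l * k). exp (- h * (l * k)) < law (l * k) x}. law (l * k) x) \<le> \<beta> ^ l" for l
  proof -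
    let ?n = "l * k"
    have "(\<Sum>x\<in>{x\<in>window ?n. exp (- h * ?n) < law ?n x}. law ?n x)
      \<le> (\<Sum>x\<in>{x\<in>window ?n. exp (- h * ?n) < law ?n x}. exp (s * (h * ?n)) * law ?n x powr (1 + s))"
    proof (intro sum_mono)
      fix x assume "x \<in> {x\<in>window ?n. exp (- h * ?n) < law ?n x}"
      then have x: "exp (- h * ?n) < law ?n x" by simp
      have "exp (- (s * (h * ?n))) = exp (- h * ?n) powr s" by (simp add: powr_def mult_ac)
      also have "\<dots> \<le> law ?n x powr s" using x s by (intro powr_mono2) auto
      finally have "1 \<le> exp (s * (h * ?n)) * law ?n x powr s" by (simp add: exp_minus field_simps)
      then have "law ?n x * 1 \<le> law ?n x * (exp (s * (h * ?n)) * law ?n x powr s)" by (intro mult_left_mono) auto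
      then show "law ?n x \<le> exp (s * (h * ?n)) * law ?n x powr (1 + s)" by (simp add: powr_add mult_ac)
    qed
    also have "\<dots> \<le> exp (s * (h * ?n)) * power_sum (1 + s) ?n"
      unfolding power_sum_def sum_distrib_left by (intro sum_mono2) auto
    also have "\<dots> \<le> exp (s * (h * ?n)) * (2 powr s * power_sum (1 + s) k) ^ l"
      using s by (intro mult_left_mono power_sum_mult_le powr_sum_ge) auto
    also have "\<dots> = \<beta>0 ^ l" by (simp add: \<beta>0_def power_mult_distrib mult_ac flip: exp_of_nat_mult)
    also have "\<dots> \<le> \<beta> ^ l" using \<beta>0 by (intro power_mono) auto
    finally show ?thesis .
  qed
  ultimately show ?thesis using k by blast
qed

text \<open>Markov's inequality for the power \<open>1 - s\<close>. Powers below 1 are subadditive, so here nothing is lost when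
  digits are joined, and all \<open>n\<close> can be treated.\<close>

lemma light_atoms_rare:
  assumes h: "asymptotic_entropy 2 steps < h"
  shows "(\<lambda>n. \<Sum>x\<in>{x\<in>window n. law n x < exp (- h * n)}. law n x) \<longlonglongrightarrow> 0"
proof -
  have "\<forall>\<^sub>F k in sequentially. ent k / real k < h"
    using order_tendstoD(2)[OF ent_limit h] .
  then obtain k where k: "0 < k" "ent k / real k < h"
    using eventually_happens'[OF sequentially_bot eventually_conj[OF _ eventually_gt_at_top[of "0::nat"]]] by blast
  then have neg: "ent k - h * k < 0" by (simp add: field_simps)
  have "((\<lambda>s. power_sum (1 - s) k) has_real_derivative - ent k * - 1) (at 0)"
    by (rule DERIV_chain2) (use power_sum_deriv in \<open>auto intro!: derivative_eq_intros\<close>)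
  moreover have "((\<lambda>s. exp (- (s * (h * k)))) has_real_derivative - (h * k)) (at 0)"
    by (auto intro!: derivative_eq_intros)
  ultimately have "((\<lambda>s. exp (- (s * (h * k))) * power_sum (1 - s) k) has_real_derivative
      - (h * k) * power_sum (1 - 0) k + (- ent k * - 1) * exp (- (0 * (h * k)))) (at 0)"
    by (intro DERIV_mult)
  then have "((\<lambda>s. exp (- (s * (h * k))) * power_sum (1 - s) k) has_real_derivative ent k - h * k) (at 0)"
    by (simp add: power_sum_1)
  from dip_below_one[OF this neg _ zero_less_one]
  obtain s where s: "0 < s" "s < 1" "exp (- (s * (h * k))) * power_sum (1 - s) k < 1"
    by (auto simp: power_sum_1)
  define \<beta> where "\<beta> = exp (- (s * (h * k))) * power_sum (1 - s) k"
  have \<beta>: "0 \<le> \<beta>" "\<beta> < 1" using s by (auto simp: \<beta>_def power_sum_nonneg)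
  have sub: "(a + b) powr (1 - s) \<le> 1 * (a powr (1 - s) + b powr (1 - s))" if "0 \<le> a" "0 \<le> b" for a b
    using powr_sum_le[OF that, of "1 - s"] s by simp
  define C where "C = Max ((\<lambda>r. exp (- (s * (h * r))) * power_sum (1 - s) r) ` {..<k})"
  have bound: "(\<Sum>x\<in>{x\<in>window n. law n x < exp (- h * n)}. law n x) \<le> \<beta> ^ (n div k) * C" for n
  proof -
    have "(\<Sum>x\<in>{x\<in>window n. law n x < exp (- h * n)}. law n x)
      \<le> (\<Sum>x\<in>{x\<in>window n. law n x < exp (- h * n)}. exp (- (s * (h * n))) * law n x powr (1 - s))"
    proof (intro sum_mono)
      fix x assume "x \<in> {x\<in>window n. law n x < exp (- h * n)}"
      then have x: "law n x < exp (- h * n)" by simp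
      have "law n x = law n x powr s * law n x powr (1 - s)"
        by (cases "law n x = 0") (simp_all add: powr_add[symmetric])
      also have "\<dots> \<le> exp (- h * n) powr s * law n x powr (1 - s)"
        using x s by (intro mult_right_mono powr_mono2) auto
      also have "exp (- h * n) powr s = exp (- (s * (h * n)))" by (simp add: powr_def mult_ac)
      finally show "law n x \<le> exp (- (s * (h * n))) * law n x powr (1 - s)" .
    qed
    also have "\<dots> \<le> exp (- (s * (h * n))) * power_sum (1 - s) n"
      unfolding power_sum_def sum_distrib_left by (intro sum_mono2) auto
    also have "power_sum (1 - s) n \<le> power_sum (1 - s) (n div k * k) * power_sum (1 - s) (n mod k)"
      using power_sum_add_le[of "1 - s" 1 "n div k * k" "n mod k", OF sub] by simp
    also have "power_sum (1 - s) (n div k * k) \<le> power_sum (1 - s) k ^ (n div k)"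
      using power_sum_mult_le[of "1 - s" 1 "n div k" k, OF sub] by simp
    also have "exp (- (s * (h * n))) * (power_sum (1 - s) k ^ (n div k) * power_sum (1 - s) (n mod k))
      = \<beta> ^ (n div k) * (exp (- (s * (h * real (n mod k)))) * power_sum (1 - s) (n mod k))"
    proof -
      have "real n = real (n div k) * k + real (n mod k)" by (metis div_mult_mod_eq of_nat_add of_nat_mult)
      then have "exp (- (s * (h * n))) = exp (- (s * (h * k))) ^ (n div k) * exp (- (s * (h * real (n mod k))))"
        by (simp add: algebra_simps flip: exp_of_nat_mult exp_add)
      then show ?thesis by (simp add: \<beta>_def power_mult_distrib mult_ac)
    qed
    also have "\<dots> \<le> \<beta> ^ (n div k) * C"
      unfolding C_def using \<beta> k by (intro mult_left_mono Max_ge) auto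
    finally show ?thesis by (simp add: mult_left_mono mult_right_mono power_sum_nonneg)
  qed
  have flt: "filterlim (\<lambda>n. n div k) sequentially sequentially"
    unfolding filterlim_at_top
  proof (intro allI)
    fix Z
    show "\<forall>\<^sub>F n in sequentially. Z \<le> n div k"
      using eventually_ge_at_top[of "Z * k"]
    proof eventually_elim
      case (elim n)
      then show ?case using k by (simp add: less_eq_div_iff_mult_less_eq)
    qed
  qed
  have "(\<lambda>n. \<beta> ^ (n div k)) \<longlonglongrightarrow> 0"
    using \<beta> by (intro filterlim_compose[OF LIMSEQ_power_zero flt]) simp
  then have "(\<lambda>n. \<beta> ^ (n div k) * C) \<longlonglongrightarrow> 0" by (rule tendsto_mult_left_zero)
  then show ?thesis
    by (rule real_tendsto_sandwich[OF _ _ tendsto_const, rotated 2])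
      (intro always_eventually allI sum_nonneg bound law_nonneg)+
qed

section \<open>Fourier transforms of the walk and of its truncated blocks\<close>

lemma fourier_law_1: "fourier 1 (law 1) \<alpha> = of_real ((1 + 2 * cos (2 * pi * \<alpha>)) / 3)"
proof -
  have "fourier 1 (law 1) \<alpha> = (\<Sum>x\<in>{-1, 0, 1}. of_real (1 / 3) * cis (2 * pi * \<alpha> * of_int x))"
    unfolding fourier_def window_1 by (intro sum.cong refl) (simp add: law_1_eq[unfolded One_nat_def])
  then show ?thesis by (simp add: complex_eq_iff)
qed

lemma cos_nonpos_digit:
  fixes y q :: nat
  assumes q: "q > 0" and d: "(4 * y div q) mod 4 \<in> {1, 2}"
  shows "cos (2 * pi * (real y / real q)) \<le> 0"
proof -
  define k where "k = 4 * y div q div 4"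
  define f where "f = real y / real q - real k"
  have "4 * y div q = 4 * k + (4 * y div q) mod 4" by (simp add: k_def)
  then have "4 * k + 1 \<le> 4 * y div q" "4 * y div q < 4 * k + 3" using d by auto
  then have "(4 * k + 1) * q \<le> 4 * y" "4 * y < (4 * k + 3) * q"
    using q by (auto simp: less_eq_div_iff_mult_less_eq div_less_iff_less_mult)
  then have "real ((4 * k + 1) * q) \<le> real (4 * y)" "real (4 * y) < real ((4 * k + 3) * q)"
    by (simp_all only: of_nat_le_iff of_nat_less_iff)
  then have f: "1 / 4 \<le> f" "f \<le> 3 / 4" using q by (simp_all add: f_def field_simps)
  have "2 * pi * (real y / real q) = 2 * pi * f + 2 * real k * pi"
    by (simp add: f_def algebra_simps)
  then have "cos (2 * pi * (real y / real q)) = cos (2 * pi * f)" by (simp add: cos_add)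
  also have "\<dots> = - cos (2 * pi * f - pi)" by (simp add: cos_diff)
  also have "\<dots> \<le> 0"
  proof -
    have "2 * pi * (1 / 4) \<le> 2 * pi * f" "2 * pi * f \<le> 2 * pi * (3 / 4)"
      using f by (intro mult_left_mono; simp)+
    then have "0 \<le> cos (2 * pi * f - pi)" by (intro cos_ge_zero) linarith+
    then show ?thesis by linarith
  qed
  finally show ?thesis .
qed

text \<open>The transform is the product of the factors \<open>(1 + 2 cos (2 \<pi> 2^j x/q)) / 3\<close>. If the digits at \<open>j\<close>
  differ, then \<open>2^j x/q\<close> is at distance at least \<open>1/4\<close> from the integers, the cosine is in \<open>[-1, 0]\<close>,
  and the factor is at most \<open>1/3\<close> in absolute value.\<close>

lemma norm_fourier_law_le:
  assumes q: "q > 0"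
  shows "norm (fourier n (law n) (real x / real q)) \<le> (1 / 3) ^ flips n x q"
proof (induction n)
  case 0
  show ?case using norm_fourier_le[of "law 0" 0] sum_law[of 0] by simp
next
  case (Suc n)
  define c where "c = cos (2 * pi * (real (2 ^ n * x) / real q))"
  let ?b = "(2 ^ (n + 2) * x div q) mod 4 \<in> {1, 2}"
  have "\<bar>1 + 2 * c\<bar> / 3 \<le> (if ?b then 1 / 3 else 1)"
  proof (cases ?b)
    case True
    then have "c \<le> 0" unfolding c_def by (intro cos_nonpos_digit q) (simp add: mult.assoc)
    moreover have "-1 \<le> c" by (simp add: c_def)
    ultimately show ?thesis using True by simp
  next
    case False
    moreover have "-1 \<le> c" "c \<le> 1" by (simp_all add: c_def)
    ultimately show ?thesis by simp
  qed
  moreover have "norm (fourier (n + 1) (law (n + 1)) (real x / real q))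
      = norm (fourier n (law n) (real x / real q)) * (\<bar>1 + 2 * c\<bar> / 3)"
  proof -
    have "fourier 1 (law 1) (2 ^ n * (real x / real q)) = of_real ((1 + 2 * c) / 3)"
      unfolding fourier_law_1 c_def by simp
    then show ?thesis
      unfolding law_add by (subst fourier_join) (auto simp: law_outside norm_mult simp del: of_real_add of_real_mult of_real_divide)
  qed
  ultimately have "norm (fourier (Suc n) (law (Suc n)) (real x / real q))
      \<le> (1 / 3) ^ flips n x q * (if ?b then 1 / 3 else 1)"
    unfolding Suc_eq_plus1 by (simp only:) (intro mult_mono Suc, auto)
  also have "(1 / 3) ^ flips n x q * (if ?b then 1 / 3 else 1) = (1 / 3 :: real) ^ flips (Suc n) x q"
    unfolding flips_Suc by (cases ?b) simp_all
  finally show ?case .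
qed

text \<open>The blocks may have different densities. In particular \<open>law 0\<close>, the point mass at 0, removes a block
  without moving the others.\<close>

primrec chain :: "nat \<Rightarrow> (nat \<Rightarrow> int \<Rightarrow> real) \<Rightarrow> nat \<Rightarrow> int \<Rightarrow> real" where
  "chain m g 0 = law 0"
| "chain m g (Suc j) = join (j * m) m (chain m g j) (g j)"

lemma chain_outside: "x \<notin> window (j * m) \<Longrightarrow> chain m g j x = 0"
proof (induction j arbitrary: x)
  case (Suc j)
  have "x \<notin> window (j * m + m)" using Suc.prems by (simp add: add.commute)
  then show ?case unfolding chain.simps using Suc.IH by (intro join_outside)
qed (simp add: law_outside)

lemma chain_nonneg: "(\<And>i x. 0 \<le> g i x) \<Longrightarrow> 0 \<le> chain m g j x"
  by (induction j arbitrary: x) (simp_all add: join_nonneg)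

lemma chain_le:
  assumes "\<And>i x. 0 \<le> g i x" "\<And>i x. g i x \<le> b i" "\<And>i x. x \<notin> window m \<Longrightarrow> g i x = 0"
  shows "chain m g j x \<le> (\<Prod>i<j. 2 * b i)"
proof (induction j arbitrary: x)
  case (Suc j)
  have "chain m g (Suc j) x \<le> 2 * b j * (\<Prod>i<j. 2 * b i)"
    unfolding chain.simps
    by (rule join_le) (use assms Suc chain_outside chain_nonneg[OF assms(1)] in auto)
  then show ?case by (simp add: mult_ac)
qed (simp add: law_le_1)

lemma chain_le_law:
  assumes "\<And>i x. 0 \<le> g i x" "\<And>i x. g i x \<le> law m x"
  shows "chain m g j x \<le> law (j * m) x"
proof (induction j arbitrary: x)
  case (Suc j)
  have "law (j * m + m) x = join (j * m) m (law (j * m)) (law m) x" by (simp add: law_add)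
  moreover have "chain m g (Suc j) x \<le> join (j * m) m (law (j * m)) (law m) x"
    unfolding chain.simps by (intro join_mono Suc assms chain_nonneg)
  ultimately show ?case by (simp add: add.commute)
qed simp

lemma sum_chain: "(\<Sum>x\<in>window (j * m). chain m g j x) = (\<Prod>i<j. \<Sum>x\<in>window m. g i x)"
proof (induction j)
  case (Suc j)
  have "(\<Sum>x\<in>window (j * m + m). chain m g (Suc j) x)
      = (\<Sum>x\<in>window m. g j x) * (\<Sum>x\<in>window (j * m). chain m g j x)"
    unfolding chain.simps by (rule sum_join_self) (rule chain_outside)
  then show ?case using Suc by (simp add: add.commute mult.commute)
qed (simp add: sum_law[of 0])

lemma fourier_law_0: "fourier m (law 0) \<alpha> = 1"
proof -
  have "fourier m (law 0) \<alpha> = (\<Sum>x\<in>window m. if x = 0 then 1 else 0)"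
    unfolding fourier_def by (intro sum.cong refl) (simp add: law_0)
  then show ?thesis by (simp add: mem_window)
qed

lemma fourier_chain: "fourier (j * m) (chain m g j) \<alpha> = (\<Prod>i<j. fourier m (g i) (2 ^ (i * m) * \<alpha>))"
proof (induction j)
  case (Suc j)
  have "fourier (j * m + m) (chain m g (Suc j)) \<alpha>
      = fourier (j * m) (chain m g j) \<alpha> * fourier m (g j) (2 ^ (j * m) * \<alpha>)"
    unfolding chain.simps by (rule fourier_join) (rule chain_outside)
  then show ?case using Suc by (simp add: add.commute)
qed (simp add: fourier_law_0)

lemma norm_fourier_chain_drop:
  assumes t: "t < j"
  shows "norm (fourier (j * m) (chain m g j) \<alpha>)
    = norm (fourier m (g t) (2 ^ (t * m) * \<alpha>)) * norm (fourier (j * m) (chain m (g(t := law 0)) j) \<alpha>)"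
proof -
  have "(\<Prod>i<j. fourier m ((g(t := law 0)) i) (2 ^ (i * m) * \<alpha>))
      = (\<Prod>i\<in>{..<j} - {t}. fourier m (g i) (2 ^ (i * m) * \<alpha>))"
    using t by (subst prod.remove[of _ t]) (auto simp: fourier_law_0 intro!: prod.cong)
  moreover have "(\<Prod>i<j. fourier m (g i) (2 ^ (i * m) * \<alpha>)) = fourier m (g t) (2 ^ (t * m) * \<alpha>)
      * (\<Prod>i\<in>{..<j} - {t}. fourier m (g i) (2 ^ (i * m) * \<alpha>))"
    using t by (subst prod.remove[of _ t]) auto
  ultimately show ?thesis unfolding fourier_chain by (simp only: norm_mult)
qed

definition trunc :: "real \<Rightarrow> nat \<Rightarrow> int \<Rightarrow> real" where
  "trunc h n x = (if law n x \<le> exp (- h * n) then law n x else 0)"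

lemma trunc_bounds: "0 \<le> trunc h n x" "trunc h n x \<le> law n x" "trunc h n x \<le> exp (- h * n)"
  by (auto simp: trunc_def)

lemma trunc_outside: "x \<notin> window n \<Longrightarrow> trunc h n x = 0"
  by (simp add: trunc_def law_outside)

lemma sum_law_minus_trunc:
  "(\<Sum>x\<in>window n. law n x - trunc h n x) = (\<Sum>x\<in>{x\<in>window n. exp (- h * n) < law n x}. law n x)"
proof -
  have "(\<Sum>x\<in>{x\<in>window n. exp (- h * n) < law n x}. law n x)
      = (\<Sum>x\<in>window n. if exp (- h * n) < law n x then law n x else 0)"
    by (rule sum.inter_filter) simp
  also have "\<dots> = (\<Sum>x\<in>window n. law n x - trunc h n x)"
    by (intro sum.cong refl) (auto simp: trunc_def)
  finally show ?thesis by simp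
qed

text \<open>Some block sees at least its share \<open>\<epsilon> m\<close> of the changes. There the truncated density has a Fourier
  coefficient within \<open>b\<close> of that of the walk.\<close>

lemma fourier_block_gain:
  fixes h \<epsilon> b :: real
  assumes q: "q > 0" and T: "0 < T"
    and b: "(\<Sum>x\<in>window m. law m x - trunc h m x) \<le> b"
    and fl: "\<epsilon> * (T * m) \<le> flips (T * m) x q"
  shows "\<exists>t<T. norm (fourier (T * m) (chain m (\<lambda>_. trunc h m) T) (real x / real q))
    \<le> ((1 / 3) powr (\<epsilon> * m) + b)
      * norm (fourier (T * m) (chain m ((\<lambda>_. trunc h m)(t := law 0)) T) (real x / real q))"
proof -
  have "\<exists>t<T. \<epsilon> * m \<le> flips m (2 ^ (t * m) * x) q"
  proof (rule ccontr)
    assume "\<not> ?thesis"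
    then have "(\<Sum>t<T. real (flips m (2 ^ (m * t) * x) q)) < (\<Sum>t<T. \<epsilon> * m)"
      using T by (intro sum_strict_mono) (auto simp: not_le mult.commute)
    moreover have "real (flips (T * m) x q) = (\<Sum>t<T. real (flips m (2 ^ (m * t) * x) q))"
      by (simp add: flips_blocks mult.commute[of T m])
    ultimately show False using fl by (simp add: mult_ac)
  qed
  then obtain t where t: "t < T" "\<epsilon> * m \<le> flips m (2 ^ (t * m) * x) q" by blast
  define \<alpha> where "\<alpha> = 2 ^ (t * m) * (real x / real q)"
  have \<alpha>: "\<alpha> = real (2 ^ (t * m) * x) / real q" by (simp add: \<alpha>_def)
  have "norm (fourier m (law m) \<alpha>) \<le> (1 / 3) ^ flips m (2 ^ (t * m) * x) q"
    unfolding \<alpha> by (rule norm_fourier_law_le[OF q])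
  also have "\<dots> = (1 / 3) powr real (flips m (2 ^ (t * m) * x) q)" by (simp add: powr_realpow)
  also have "\<dots> \<le> (1 / 3) powr (\<epsilon> * m)" using t by (intro powr_mono') auto
  finally have 1: "norm (fourier m (law m) \<alpha>) \<le> (1 / 3) powr (\<epsilon> * m)" .
  have "norm (fourier m (trunc h m) \<alpha> - fourier m (law m) \<alpha>) \<le> (\<Sum>x\<in>window m. \<bar>trunc h m x - law m x\<bar>)"
    by (rule norm_fourier_diff_le)
  also have "\<dots> = (\<Sum>x\<in>window m. law m x - trunc h m x)"
    by (intro sum.cong refl) (simp add: trunc_bounds abs_minus_commute)
  also have "\<dots> \<le> b" by (rule b)
  finally have "norm (fourier m (trunc h m) \<alpha>) \<le> (1 / 3) powr (\<epsilon> * m) + b"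
    using 1 norm_triangle_sub[of "fourier m (trunc h m) \<alpha>" "fourier m (law m) \<alpha>"] by linarith
  then have "norm (fourier m (trunc h m) \<alpha>)
      * norm (fourier (T * m) (chain m ((\<lambda>_. trunc h m)(t := law 0)) T) (real x / real q))
    \<le> ((1 / 3) powr (\<epsilon> * m) + b)
      * norm (fourier (T * m) (chain m ((\<lambda>_. trunc h m)(t := law 0)) T) (real x / real q))"
    by (rule mult_right_mono) simp
  then show ?thesis
    using t(1) norm_fourier_chain_drop[OF t(1), of m "\<lambda>_. trunc h m" "real x / real q"]
    by (intro exI[of _ t] conjI) (simp_all only: \<alpha>_def)
qed

lemma prod_drop_one: "t < T \<Longrightarrow> (\<Prod>i<T. 2 * (if i = t then 1 else w)) = 2 ^ T * w ^ (T - 1)" for w :: real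
proof -
  assume t: "t < T"
  have "(\<Prod>i<T. if i = t then 1 else w) = (\<Prod>i\<in>{..<T} - {t}. if i = t then 1 else w)"
    using t by (subst prod.remove[of _ t]) auto
  also have "\<dots> = (\<Prod>i\<in>{..<T} - {t}. w)" by (rule prod.cong) auto
  also have "\<dots> = w ^ (T - 1)" using t by (simp add: card_Diff_singleton)
  finally show ?thesis by (simp add: prod.distrib)
qed

text \<open>Different frequencies may gain in different blocks. The density is the same for all of them; only the
  bound involves the block \<open>t\<close>, through the density with this block removed, and the bounds for all \<open>t\<close>
  are added.\<close>

lemma sum_fourier_generic_le:
  fixes h \<epsilon> b D :: real
  assumes T: "0 < T" and b: "(\<Sum>x\<in>window m. law m x - trunc h m x) \<le> b"
    and dv: "\<And>z. 0 < z \<Longrightarrow> z < 2 ^ (T * m + 1) \<Longrightarrow> real (num_divisors z) \<le> D"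
    and G: "G \<subseteq> {1..Q}" "\<And>q x. q \<in> G \<Longrightarrow> 0 < x \<Longrightarrow> x < q \<Longrightarrow> \<epsilon> * (T * m) \<le> flips (T * m) x q"
  shows "(\<Sum>q\<in>G. \<Sum>x\<in>{1..<q}. (norm (fourier (T * m) (chain m (\<lambda>_. trunc h m) T) (real x / real q)))\<^sup>2)
    \<le> ((1 / 3) powr (\<epsilon> * m) + b)\<^sup>2 * (T * (real Q * (real Q * (2 ^ T * exp (- h * m) ^ (T - 1)) + D)))"
proof -
  define g where "g t = (\<lambda>_. trunc h m)(t := law 0)" for t :: nat
  define A where "A t q x = (norm (fourier (T * m) (chain m (g t) T) (real x / real q)))\<^sup>2" for t q x :: nat
  define B where "B = ((1 / 3) powr (\<epsilon> * m) + b)\<^sup>2"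
  have g: "0 \<le> g t i x" "g t i x \<le> (if i = t then 1 else exp (- h * m))"
    "x \<notin> window m \<Longrightarrow> g t i x = 0" for t i x
    using trunc_bounds[of h m x] law_le_1[of 0 x] by (auto simp: g_def trunc_outside law_0 mem_window)
  have mass: "(\<Sum>x\<in>window m. g t i x) \<le> 1" for t i
  proof (cases "i = t")
    case True
    then show ?thesis by (simp add: g_def law_0 mem_window)
  next
    case False
    have "(\<Sum>x\<in>window m. trunc h m x) \<le> (\<Sum>x\<in>window m. law m x)" by (intro sum_mono trunc_bounds)
    then show ?thesis using False by (simp add: g_def sum_law)
  qed
  have total: "(\<Sum>q\<in>{1..Q}. \<Sum>x<q. A t q x) \<le> real Q * (real Q * (2 ^ T * exp (- h * m) ^ (T - 1)) + D)" if "t < T" for t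
    unfolding A_def
  proof (rule sum_fourier_sq_le)
    show "chain m (g t) T x \<le> 2 ^ T * exp (- h * m) ^ (T - 1)" for x
      using chain_le[of "g t" "\<lambda>i. if i = t then 1 else exp (- h * m)" m T x] g
      unfolding prod_drop_one[OF that] by blast
    show "(\<Sum>x\<in>window (T * m). chain m (g t) T x) \<le> 1"
      unfolding sum_chain by (intro prod_le_1) (auto intro!: sum_nonneg g mass)
  qed (use dv g chain_nonneg in auto)
  have "(\<Sum>q\<in>G. \<Sum>x\<in>{1..<q}. (norm (fourier (T * m) (chain m (\<lambda>_. trunc h m) T) (real x / real q)))\<^sup>2)
      \<le> (\<Sum>q\<in>G. \<Sum>x\<in>{1..<q}. B * (\<Sum>t<T. A t q x))"
  proof (intro sum_mono)
    fix q x assume q: "q \<in> G" and x: "x \<in> {1..<q}"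
    have "\<epsilon> * (T * m) \<le> flips (T * m) x q" using G(2)[of q x] q x by auto
    from fourier_block_gain[OF _ T b this] q x obtain t where t: "t < T"
      and le: "norm (fourier (T * m) (chain m (\<lambda>_. trunc h m) T) (real x / real q))
        \<le> ((1 / 3) powr (\<epsilon> * m) + b) * norm (fourier (T * m) (chain m (g t) T) (real x / real q))"
      by (auto simp: g_def)
    have "(norm (fourier (T * m) (chain m (\<lambda>_. trunc h m) T) (real x / real q)))\<^sup>2 \<le> B * A t q x"
      using power_mono[OF le, of 2] by (simp add: A_def B_def power_mult_distrib)
    also have "A t q x \<le> (\<Sum>t<T. A t q x)" using t by (intro member_le_sum) (auto simp: A_def)
    finally show "(norm (fourier (T * m) (chain m (\<lambda>_. trunc h m) T) (real x / real q)))\<^sup>2 \<le> B * (\<Sum>t<T. A t q x)"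
      by (simp add: B_def mult_left_mono)
  qed
  also have "\<dots> \<le> (\<Sum>q\<in>{1..Q}. \<Sum>x<q. B * (\<Sum>t<T. A t q x))"
  proof -
    have "(\<Sum>x\<in>{1..<q}. B * (\<Sum>t<T. A t q x)) \<le> (\<Sum>x<q. B * (\<Sum>t<T. A t q x))" for q
      by (intro sum_mono2) (auto simp: A_def B_def intro!: mult_nonneg_nonneg sum_nonneg)
    then have "(\<Sum>q\<in>G. \<Sum>x\<in>{1..<q}. B * (\<Sum>t<T. A t q x)) \<le> (\<Sum>q\<in>G. \<Sum>x<q. B * (\<Sum>t<T. A t q x))"
      by (rule sum_mono)
    also have "\<dots> \<le> (\<Sum>q\<in>{1..Q}. \<Sum>x<q. B * (\<Sum>t<T. A t q x))"
      using G(1) by (intro sum_mono2) (auto simp: A_def B_def intro!: mult_nonneg_nonneg sum_nonneg)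
    finally show ?thesis .
  qed
  also have "\<dots> = B * (\<Sum>t<T. \<Sum>q\<in>{1..Q}. \<Sum>x<q. A t q x)"
  proof -
    have "(\<Sum>q\<in>{1..Q}. \<Sum>x<q. \<Sum>t<T. A t q x) = (\<Sum>q\<in>{1..Q}. \<Sum>t<T. \<Sum>x<q. A t q x)"
      by (intro sum.cong refl sum.swap)
    also have "\<dots> = (\<Sum>t<T. \<Sum>q\<in>{1..Q}. \<Sum>x<q. A t q x)" by (rule sum.swap)
    finally show ?thesis by (simp only: sum_distrib_left[symmetric])
  qed
  also have "\<dots> \<le> B * (\<Sum>t<T. real Q * (real Q * (2 ^ T * exp (- h * m) ^ (T - 1)) + D))"
    by (intro mult_left_mono sum_mono total) (auto simp: B_def)
  finally show ?thesis by (simp add: B_def)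
qed

lemma sum_chain_trunc_ge:
  assumes b: "(\<Sum>x\<in>window m. law m x - trunc h m x) \<le> b" and "b \<le> 1"
  shows "1 - T * b \<le> (\<Sum>x\<in>window (T * m). chain m (\<lambda>_. trunc h m) T x)"
proof -
  have "1 - b \<le> (\<Sum>x\<in>window m. trunc h m x)" using b by (simp add: sum_subtractf sum_law)
  then have "(1 - b) ^ T \<le> (\<Sum>x\<in>window m. trunc h m x) ^ T" using \<open>b \<le> 1\<close> by (intro power_mono) auto
  moreover have "1 + T * (- b) \<le> (1 + - b) ^ T" using \<open>b \<le> 1\<close> by (intro Bernoulli_inequality) simp
  ultimately show ?thesis unfolding sum_chain by simp
qed

section \<open>The mixing time\<close>

text \<open>Compare the two measures on the residues of \<open>S\<close>.\<close>

lemma walk_dist_ge: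
  assumes q: "q > 0" and S: "S \<subseteq> window n"
  shows "2 * ((\<Sum>x\<in>S. law n x) - card S / q) \<le> walk_dist 2 steps q n"
proof -
  let ?p = "fold_mod q n (law n)" and ?R = "residues_mod q"
  define R' where "R' = (\<lambda>x. x mod int q) ` S"
  have R': "R' \<subseteq> ?R" using q by (auto simp: R'_def residues_mod_def)
  have fS: "finite S" using S by (rule finite_subset) simp
  have fR: "finite R'" using fS by (simp add: R'_def)
  have "(\<Sum>x\<in>S. law n x) \<le> (\<Sum>r\<in>R'. ?p r)"
  proof -
    have "(\<Sum>x\<in>S. law n x) \<le> (\<Sum>x\<in>window n. law n x * of_bool (x mod int q \<in> R'))"
      using S fS by (intro order_trans[OF _ sum_mono2[of "window n" S]]) (auto simp: R'_def)
    also have "\<dots> = (\<Sum>r\<in>?R. ?p r * of_bool (r \<in> R'))" by (rule sum_fold_mod[OF q, symmetric])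
    also have "\<dots> = (\<Sum>r\<in>R'. ?p r * of_bool (r \<in> R'))"
      using R' by (intro sum.mono_neutral_right) auto
    also have "\<dots> = (\<Sum>r\<in>R'. ?p r)" by (intro sum.cong) auto
    finally show ?thesis .
  qed
  moreover have "real (card R') \<le> real (card S)" unfolding R'_def using fS by (simp add: card_image_le)
  then have "card R' / q \<le> card S / q" by (intro divide_right_mono) auto
  ultimately have "(\<Sum>x\<in>S. law n x) - card S / q \<le> (\<Sum>r\<in>R'. ?p r - 1 / q)"
    by (simp add: sum_subtractf)
  also have "2 * (\<Sum>r\<in>R'. ?p r - 1 / q) = (\<Sum>r\<in>R'. ?p r - 1 / q) - (\<Sum>r\<in>?R - R'. ?p r - 1 / q)"
  proof -
    have "(\<Sum>r\<in>?R. ?p r - 1 / q) = 0"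
      using q sum_fold_mod[OF q, of n "law n" "\<lambda>_. 1"] by (simp add: sum_subtractf sum_law card_residues_mod)
    then show ?thesis using sum.subset_diff[OF R', of "\<lambda>r. ?p r - 1 / q"] by simp
  qed
  also have "\<dots> \<le> (\<Sum>r\<in>R'. \<bar>?p r - 1 / q\<bar>) + (\<Sum>r\<in>?R - R'. \<bar>?p r - 1 / q\<bar>)"
  proof -
    have "(\<Sum>r\<in>R'. ?p r - 1 / q) \<le> (\<Sum>r\<in>R'. \<bar>?p r - 1 / q\<bar>)" by (intro sum_mono) simp
    moreover have "- (\<Sum>r\<in>?R - R'. ?p r - 1 / q) \<le> (\<Sum>r\<in>?R - R'. \<bar>?p r - 1 / q\<bar>)"
      unfolding sum_negf[symmetric] by (intro sum_mono) linarith
    ultimately show ?thesis by linarith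
  qed
  also have "\<dots> = walk_dist 2 steps q n"
    unfolding walk_dist_eq[OF q] using sum.subset_diff[OF R', of "\<lambda>r. \<bar>?p r - 1 / q\<bar>"] by simp
  finally show ?thesis by simp
qed

lemma card_heavy_le: "real (card {x\<in>window n. exp (- h * n) \<le> law n x}) \<le> exp (h * n)"
proof -
  let ?S = "{x\<in>window n. exp (- h * n) \<le> law n x}"
  have "card ?S * exp (- h * n) = (\<Sum>x\<in>?S. exp (- h * n))" by simp
  also have "\<dots> \<le> (\<Sum>x\<in>?S. law n x)" by (intro sum_mono) simp
  also have "\<dots> \<le> (\<Sum>x\<in>window n. law n x)" by (intro sum_mono2) auto
  finally show ?thesis by (simp add: sum_law exp_minus field_simps)
qed

text \<open>Up to time \<open>\<theta> log_2 q\<close> the set carrying most of the mass has at most \<open>exp (h n) \<le> q^(\<theta> h / ln 2)\<close> elements,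
  and \<open>h\<close> can be chosen above the entropy with \<open>\<theta> h < ln 2\<close>. The finitely many \<open>n < n0\<close> for which the tail
  bound is not yet effective have bounded support.\<close>

lemma not_mixed_early:
  fixes \<theta> \<eta> :: real
  assumes H: "0 < asymptotic_entropy 2 steps" and \<theta>: "\<theta> * asymptotic_entropy 2 steps < ln 2" and \<eta>: "0 < \<eta>"
  shows "\<forall>\<^sub>F q in sequentially. \<forall>n::nat. real n \<le> \<theta> * log 2 (real q) \<longrightarrow> 1 / 2 * walk_dist 2 steps q n \<ge> 1 - \<eta>"
proof -
  define H where "H = asymptotic_entropy 2 steps"
  obtain h where h: "H < h" "\<theta> * h < ln 2"
  proof (cases "0 < \<theta>")
    case True
    then have "H < ln 2 / \<theta>" using \<theta> by (simp add: H_def field_simps)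
    then obtain h where "H < h" "h < ln 2 / \<theta>" using dense by blast
    then show ?thesis using True that[of h] by (simp add: field_simps)
  next
    case False
    have "\<theta> * (H + 1) \<le> 0" using False H by (intro mult_nonpos_nonneg) (auto simp: H_def)
    moreover have "0 < ln (2::real)" by simp
    ultimately show ?thesis using that[of "H + 1"] by linarith
  qed
  have h0: "0 < h" using h H by (simp add: H_def)
  have "\<forall>\<^sub>F n in sequentially. (\<Sum>x\<in>{x\<in>window n. law n x < exp (- h * n)}. law n x) < \<eta> / 2"
    by (rule order_tendstoD(2)[OF light_atoms_rare[OF h(1)[unfolded H_def]]]) (use \<eta> in simp)
  then obtain n0 where n0: "\<And>n. n0 \<le> n \<Longrightarrow> (\<Sum>x\<in>{x\<in>window n. law n x < exp (- h * n)}. law n x) < \<eta> / 2"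
    unfolding eventually_sequentially by blast
  define K where "K = real (card (window n0))"
  define \<tau> where "\<tau> = \<theta> * h / ln 2"
  have \<tau>: "\<tau> < 1" using h by (simp add: \<tau>_def)
  have ev1: "\<forall>\<^sub>F q in sequentially. K / real q < \<eta> / 2"
    using order_tendstoD(2)[OF lim_const_over_n, of "\<eta> / 2" K] \<eta> by simp
  have "((\<lambda>x. x powr (\<tau> - 1)) \<longlongrightarrow> 0) at_top" using \<tau> by (intro tendsto_neg_powr filterlim_ident) auto
  then have "(\<lambda>q. real q powr (\<tau> - 1)) \<longlonglongrightarrow> 0"
    by (rule filterlim_compose) (rule filterlim_real_sequentially)
  then have ev2: "\<forall>\<^sub>F q in sequentially. real q powr (\<tau> - 1) < \<eta> / 2"
    by (rule order_tendstoD(2)) (use \<eta> in simp)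
  show ?thesis
    using ev1 ev2 eventually_gt_at_top[of 1]
  proof eventually_elim
    case (elim q)
    have q: "0 < q" using elim by simp
    show ?case
    proof (intro allI impI)
      fix n assume n: "real n \<le> \<theta> * log 2 (real q)"
      obtain S where S: "S \<subseteq> window n" "1 - \<eta> / 2 \<le> (\<Sum>x\<in>S. law n x)" "card S / q \<le> \<eta> / 2"
      proof (cases "n0 \<le> n")
        case True
        let ?S = "{x\<in>window n. exp (- h * n) \<le> law n x}"
        have "window n = ?S \<union> {x\<in>window n. law n x < exp (- h * n)}" by auto
        then have "1 = (\<Sum>x\<in>?S \<union> {x\<in>window n. law n x < exp (- h * n)}. law n x)"
          using sum_law[of n] by simp
        also have "\<dots> = (\<Sum>x\<in>?S. law n x) + (\<Sum>x\<in>{x\<in>window n. law n x < exp (- h * n)}. law n x)"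
          by (rule sum.union_disjoint) auto
        finally have 1: "1 - \<eta> / 2 \<le> (\<Sum>x\<in>?S. law n x)" using n0[OF True] by linarith
        have "h * n \<le> h * (\<theta> * log 2 q)" using n h0 by (intro mult_left_mono) auto
        also have "\<dots> = \<tau> * ln q" by (simp add: \<tau>_def log_def)
        finally have "exp (h * n) \<le> real q powr \<tau>" using q by (simp add: powr_def)
        then have "card ?S / q \<le> real q powr \<tau> / q"
          using card_heavy_le[of n h] by (intro divide_right_mono) (auto intro: order_trans)
        also have "\<dots> = real q powr (\<tau> - 1)" using q by (simp add: powr_diff)
        finally have 2: "card ?S / q \<le> \<eta> / 2" using elim(2) by linarith
        show ?thesis by (rule that[OF _ 1 2]) auto
      next
        case False
        have "window n \<subseteq> window n0"
        proof
          fix x assume "x \<in> window n"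
          then have "\<bar>x\<bar> < 2 ^ n" by (simp add: mem_window)
          also have "(2::int) ^ n \<le> 2 ^ n0" using False by (intro power_increasing) auto
          finally show "x \<in> window n0" by (simp add: mem_window)
        qed
        then have "card (window n) \<le> card (window n0)" by (intro card_mono) auto
        then have "card (window n) / q \<le> K / q" by (intro divide_right_mono) (auto simp: K_def)
        then have 2: "card (window n) / q \<le> \<eta> / 2" using elim(1) by linarith
        show ?thesis by (rule that[OF subset_refl _ 2]) (use \<eta> in \<open>simp add: sum_law\<close>)
      qed
      show "1 - \<eta> \<le> 1 / 2 * walk_dist 2 steps q n"
        using walk_dist_ge[OF q S(1)] S(2,3) by simp
    qed
  qed
qed

text \<open>One step averages the three maps \<open>s \<mapsto> 2 s + y\<close>, which are bijections of the residues because \<open>q\<close> is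
  odd. They preserve the uniform measure, so the step is a contraction.\<close>

lemma walk_dist_Suc_le:
  assumes q: "odd q"
  shows "walk_dist 2 steps q (Suc n) \<le> walk_dist 2 steps q n"
proof -
  have q0: "q > 0" using q by (auto elim: oddE)
  let ?p = "\<lambda>n. fold_mod q n (law n)" and ?R = "residues_mod q"
  let ?\<phi> = "\<lambda>y s. (y + 2 * s) mod int q"
  have rec: "?p (Suc n) r = (\<Sum>y\<in>window 1. 1 / 3 * (\<Sum>s\<in>?R. ?p n s * of_bool (?\<phi> y s = r)))" for r
  proof -
    have "?p (1 + n) r = (\<Sum>x\<in>window (1 + n). of_real (join 1 n (law 1) (law n) x) * of_bool (x mod int q = r))"
      unfolding fold_mod_def law_add by (intro sum.cong refl) simp
    also have "\<dots> = (\<Sum>z\<in>window n. \<Sum>y\<in>window 1. law n z * law 1 y * of_bool ((y + 2 * z) mod int q = r))"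
      by (subst sum_join) (auto simp: law_outside)
    also have "\<dots> = (\<Sum>y\<in>window 1. \<Sum>z\<in>window n. law n z * law 1 y * of_bool ((y + 2 * z) mod int q = r))"
      by (rule sum.swap)
    also have "\<dots> = (\<Sum>y\<in>window 1. 1 / 3 * (\<Sum>z\<in>window n. law n z * of_bool (?\<phi> y (z mod int q) = r)))"
    proof (intro sum.cong refl)
      fix y assume "y \<in> window 1"
      then have y: "law 1 y = 1 / 3" by (rule law_1)
      have "(y + 2 * z) mod int q = ?\<phi> y (z mod int q)" for z by (subst (1 2) mod_add_right_eq[symmetric]) (simp only: mod_mult_right_eq)
      then show "(\<Sum>z\<in>window n. law n z * law 1 y * of_bool ((y + 2 * z) mod int q = r))
          = 1 / 3 * (\<Sum>z\<in>window n. law n z * of_bool (?\<phi> y (z mod int q) = r))"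
        by (simp only: y sum_distrib_left mult_ac)
    qed
    also have "\<dots> = (\<Sum>y\<in>window 1. 1 / 3 * (\<Sum>s\<in>?R. ?p n s * of_bool (?\<phi> y s = r)))"
      by (subst sum_fold_mod[OF q0]) (rule refl)
    finally show ?thesis by simp
  qed
  have bij: "bij_betw (?\<phi> y) ?R ?R" for y
  proof -
    have "inj_on (?\<phi> y) ?R"
    proof (rule inj_onI)
      fix s s' assume s: "s \<in> ?R" "s' \<in> ?R" and "?\<phi> y s = ?\<phi> y s'"
      then have "int q dvd 2 * (s - s')" by (simp add: mod_eq_dvd_iff algebra_simps)
      moreover have "coprime (int q) 2" using q by simp
      ultimately have "int q dvd s - s'" 
        using coprime_dvd_mult_right_iff[of "int q" 2 "s - s'"] by blast
      moreover have "\<bar>s - s'\<bar> < int q" using s by (auto simp: residues_mod_def)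
      ultimately show "s = s'" using dvd_imp_le_int[of "s - s'" "int q"] by auto
    qed
    moreover have "?\<phi> y ` ?R \<subseteq> ?R" using q0 by (auto simp: residues_mod_def)
    ultimately show ?thesis by (simp add: bij_betw_def endo_inj_surj)
  qed
  have one: "(\<Sum>s\<in>?R. of_bool (?\<phi> y s = r)) = (1::real)" if "r \<in> ?R" for y r
    using sum.reindex_bij_betw[OF bij, of "\<lambda>s. of_bool (s = r) :: real" y] that by (simp add: of_bool_def)
  have "?p (Suc n) r - 1 / q = (\<Sum>y\<in>window 1. 1 / 3 * (\<Sum>s\<in>?R. (?p n s - 1 / q) * of_bool (?\<phi> y s = r)))"
    if "r \<in> ?R" for r
  proof -
    have "(\<Sum>s\<in>?R. (?p n s - 1 / q) * of_bool (?\<phi> y s = r))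
        = (\<Sum>s\<in>?R. ?p n s * of_bool (?\<phi> y s = r)) - 1 / q" for y
      using one[OF that, of y] by (simp add: left_diff_distrib sum_subtractf sum_divide_distrib[symmetric])
    moreover have "(\<Sum>y\<in>window 1. 1 / 3 * (X y - 1 / q)) = (\<Sum>y\<in>window 1. 1 / 3 * X y) - 1 / q"
      for X :: "int \<Rightarrow> real"
      by (simp add: window_1[unfolded One_nat_def] diff_divide_distrib)
    ultimately show ?thesis by (simp only: rec)
  qed
  then have "walk_dist 2 steps q (Suc n)
      = (\<Sum>r\<in>?R. \<bar>\<Sum>y\<in>window 1. 1 / 3 * (\<Sum>s\<in>?R. (?p n s - 1 / q) * of_bool (?\<phi> y s = r))\<bar>)"
    unfolding walk_dist_eq[OF q0] by (intro sum.cong refl) simp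
  also have "\<dots> \<le> (\<Sum>r\<in>?R. \<Sum>y\<in>window 1. 1 / 3 * (\<Sum>s\<in>?R. \<bar>?p n s - 1 / q\<bar> * of_bool (?\<phi> y s = r)))"
  proof (intro sum_mono)
    fix r
    show "\<bar>\<Sum>y\<in>window 1. 1 / 3 * (\<Sum>s\<in>?R. (?p n s - 1 / q) * of_bool (?\<phi> y s = r))\<bar>
      \<le> (\<Sum>y\<in>window 1. 1 / 3 * (\<Sum>s\<in>?R. \<bar>?p n s - 1 / q\<bar> * of_bool (?\<phi> y s = r)))"
    proof (rule order_trans[OF sum_abs], intro sum_mono)
      fix y
      have "\<bar>\<Sum>s\<in>?R. (?p n s - 1 / q) * of_bool (?\<phi> y s = r)\<bar> \<le> (\<Sum>s\<in>?R. \<bar>?p n s - 1 / q\<bar> * of_bool (?\<phi> y s = r))"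
        by (rule order_trans[OF sum_abs]) (simp add: abs_mult)
      then show "\<bar>1 / 3 * (\<Sum>s\<in>?R. (?p n s - 1 / q) * of_bool (?\<phi> y s = r))\<bar>
          \<le> 1 / 3 * (\<Sum>s\<in>?R. \<bar>?p n s - 1 / q\<bar> * of_bool (?\<phi> y s = r))"
        by (simp add: abs_mult)
    qed
  qed
  also have "\<dots> = (\<Sum>y\<in>window 1. 1 / 3 * (\<Sum>s\<in>?R. \<bar>?p n s - 1 / q\<bar> * (\<Sum>r\<in>?R. of_bool (?\<phi> y s = r))))"
    by (subst sum.swap, rule sum.cong[OF refl], subst sum_distrib_left[symmetric], subst sum.swap)
      (simp only: sum_distrib_left)
  also have "\<dots> = (\<Sum>y\<in>window 1. 1 / 3 * (\<Sum>s\<in>?R. \<bar>?p n s - 1 / q\<bar>))"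
  proof -
    have "(\<Sum>r\<in>?R. of_bool (?\<phi> y s = r)) = (1::real)" for y s
      using q0 by (simp add: of_bool_def residues_mod_def)
    then show ?thesis by simp
  qed
  also have "\<dots> = walk_dist 2 steps q n"
    unfolding walk_dist_eq[OF q0] by (simp add: window_1[unfolded One_nat_def])
  finally show ?thesis .
qed

lemma walk_dist_antimono: "odd q \<Longrightarrow> N \<le> n \<Longrightarrow> walk_dist 2 steps q n \<le> walk_dist 2 steps q N"
  by (rule lift_Suc_antimono_le[where f = "walk_dist 2 steps q"]) (auto intro: walk_dist_Suc_le)

lemma block_count:
  fixes Q k T :: nat and \<theta> :: real
  assumes "1 \<le> Q" "0 < k" "0 < T" "0 < \<theta>"
  defines "l \<equiv> nat \<lfloor>\<theta> * log 2 Q / (k * T)\<rfloor>"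
  shows "real (T * (l * k)) \<le> \<theta> * log 2 Q" "\<theta> * log 2 Q - k * T \<le> real (T * (l * k))"
proof -
  define y where "y = \<theta> * log 2 Q / (k * T)"
  have "0 \<le> y" using assms by (simp add: y_def)
  then have l: "real l \<le> y" "y \<le> real l + 1" unfolding l_def y_def[symmetric] by linarith+
  have kT: "0 < real (k * T)" using assms by simp
  have y: "y * real (k * T) = \<theta> * log 2 Q" using kT by (simp add: y_def del: of_nat_mult)
  have "real l * real (k * T) \<le> y * real (k * T)" "y * real (k * T) \<le> (real l + 1) * real (k * T)"
    using l kT by (intro mult_right_mono; simp)+
  then show "real (T * (l * k)) \<le> \<theta> * log 2 Q" "\<theta> * log 2 Q - k * T \<le> real (T * (l * k))"
    unfolding y by (simp_all add: algebra_simps)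
qed

text \<open>The parameters are chosen in the order \<open>\<kappa>\<close>, \<open>\<epsilon>\<close>, \<open>h\<close>, \<open>T\<close>, \<open>k\<close>, \<open>\<gamma>\<close>, \<open>\<epsilon>2\<close>, and then the number \<open>l\<close> of pieces
  of \<open>k\<close> digits in a block grows with \<open>Q\<close>. An exceptional modulus is either small, or it has a fraction with
  few changes, or it belongs to the set \<open>G Q\<close> of moduli without such fractions and has a large Fourier
  sum; Markov's inequality bounds the number of the last ones.\<close>

lemma mixed_late:
  fixes c \<delta> \<eta> \<eta>' :: real
  assumes H: "0 < asymptotic_entropy 2 steps" and c: "c = ln 2 / asymptotic_entropy 2 steps" "1 < c"
    and \<delta>: "0 < \<delta>" and \<eta>: "0 < \<eta>" and \<eta>': "0 < \<eta>'"
  shows "\<forall>\<^sub>F Q in sequentially. real (card {q::nat. odd q \<and> q \<le> Q \<and>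
    (\<exists>n::nat. real n \<ge> (c + \<delta>) * log 2 (real q) \<and> walk_dist 2 steps q n > \<eta>)}) \<le> \<eta>' * real Q"
proof -
  define H where "H = asymptotic_entropy 2 steps"
  define \<theta> where "\<theta> = c + \<delta> / 2"
  have \<theta>: "0 < \<theta>" "1 < \<theta>" "\<theta> < c + \<delta>" using c \<delta> by (auto simp: \<theta>_def)
  define \<kappa> where "\<kappa> = min 1 ((\<theta> - 1) / 2)"
  have \<kappa>: "0 < \<kappa>" "\<kappa> \<le> 1" "1 + \<kappa> < \<theta>" using \<theta> by (auto simp: \<kappa>_def min_def field_simps)
  obtain \<epsilon> :: real where \<epsilon>: "0 < \<epsilon>" and rare: "\<And>Q N :: nat. (1 + \<kappa>) * log 2 (real Q) \<le> N \<Longrightarrow>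
    real (card {q. odd q \<and> q \<le> Q \<and> (\<exists>x. 0 < x \<and> x < q \<and> real (flips N x q) < \<epsilon> * N)}) \<le> \<eta>' / 4 * Q"
    using few_flips_rare[OF \<kappa>(1,2), of "\<eta>' / 4"] \<eta>' by auto
  have "ln 2 = c * H" using H c(1) by (simp add: H_def)
  also have "c * H < \<theta> * H" using H \<delta> by (intro mult_strict_right_mono) (auto simp: H_def \<theta>_def)
  finally have "ln 2 < \<theta> * H" .
  then have "ln 2 / \<theta> < H" using \<theta> by (simp add: field_simps)
  then obtain h where h: "ln 2 / \<theta> < h" "h < H" using dense by blast
  have h\<theta>: "ln 2 < h * \<theta>" using h \<theta> by (simp add: field_simps)
  have "0 < ln 2 / \<theta>" using \<theta> by simp
  then have h0: "0 < h" using h by linarith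
  \<comment> \<open>With \<open>T\<close> blocks the removal of one loses the proportion \<open>1 / T\<close> of the entropy. The surplus of
    \<open>h \<theta>\<close> over \<open>ln 2\<close> pays for it, so the other blocks still have density \<open>O(1 / Q)\<close>.\<close>
  obtain T0 :: nat where T0: "h * \<theta> < real T0 * (h * \<theta> - ln 2)"
    using ex_less_of_nat_mult[of "h * \<theta> - ln 2" "h * \<theta>"] h\<theta> by auto
  define T where "T = Suc T0"
  have T: "0 < T" "ln 2 * T \<le> (real T - 1) * (h * \<theta>)"
    using T0 h\<theta> by (auto simp: T_def algebra_simps)
  obtain k \<beta> where k: "0 < k" and \<beta>: "0 < \<beta>" "\<beta> < 1"
    and heavy: "\<And>l. (\<Sum>x\<in>{x\<in>window (l * k). exp (- h * (l * k)) < law (l * k) x}. law (l * k) x) \<le> \<beta> ^ l"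
    using heavy_atoms_rare[of h] h by (auto simp: H_def)
  define \<gamma> where "\<gamma> = max ((1 / 3) powr (\<epsilon> * k)) \<beta>"
  have "(1 / 3 :: real) powr (\<epsilon> * k) < 1" using \<epsilon> k by (simp add: powr_def ln_div)
  then have \<gamma>: "0 < \<gamma>" "\<gamma> < 1" "\<beta> \<le> \<gamma>" "(1 / 3) powr (\<epsilon> * k) \<le> \<gamma>" using \<beta> by (auto simp: \<gamma>_def)
  \<comment> \<open>Chosen so that the divisor bound for integers of size \<open>2^N\<close> costs \<open>\<gamma>^(-l)\<close>, while one block gains
    \<open>\<gamma>^(2 l)\<close>.\<close>
  define \<epsilon>2 where "\<epsilon>2 = - log 2 \<gamma> / (k * T)"
  have "log 2 \<gamma> < 0" using \<gamma> by simp
  then have \<epsilon>2: "0 < \<epsilon>2" using k T by (simp add: \<epsilon>2_def field_simps)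
  obtain C where C: "0 < C" "\<And>n. 0 < n \<Longrightarrow> real (num_divisors n) \<le> C * real n powr \<epsilon>2"
    using divisor_bound[OF \<epsilon>2] by auto
  define l where "l Q = nat \<lfloor>\<theta> * log 2 (real Q) / (k * T)\<rfloor>" for Q :: nat
  define m where "m Q = l Q * k" for Q
  define N where "N Q = T * m Q" for Q
  define C1 where "C1 = 2 ^ T * exp (h * k * (T - 1))"
  define C2 where "C2 = C * 2 powr \<epsilon>2"
  define E where "E = 4 * T * (C1 + C2)"
  have N: "real (N Q) \<le> \<theta> * log 2 Q" "\<theta> * log 2 Q - k * T \<le> real (N Q)" if "1 \<le> Q" for Q
    unfolding N_def m_def l_def using block_count[OF that k T(1) \<theta>(1)] by auto
  define \<rho> where "\<rho> Q = chain (m Q) (\<lambda>_. trunc h (m Q)) T" for Q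
  define S where "S Q q = (\<Sum>x\<in>{1..<q}. (norm (fourier (N Q) (\<rho> Q) (real x / real q)))\<^sup>2)" for Q q :: nat
  define G where "G Q = {q. odd q \<and> q \<le> Q \<and> (\<forall>x. 0 < x \<longrightarrow> x < q \<longrightarrow> \<epsilon> * N Q \<le> flips (N Q) x q)}" for Q
  have loss: "(\<Sum>x\<in>window (m Q). law (m Q) x - trunc h (m Q) x) \<le> \<beta> ^ l Q" for Q
    unfolding sum_law_minus_trunc m_def using heavy[of "l Q"] by simp
  have GQ: "G Q \<subseteq> {1..Q}" for Q by (auto simp: G_def elim: oddE)
  have main: "(\<Sum>q\<in>G Q. S Q q) \<le> E * \<gamma> ^ l Q * Q" if Q: "1 \<le> Q" for Q
  proof -
    define D where "D = C2 * inverse \<gamma> ^ l Q"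
    have C2: "0 < C2" using C by (simp add: C2_def)
    have pow2: "2 powr (\<epsilon>2 * N Q) = inverse \<gamma> ^ l Q"
    proof -
      have "\<epsilon>2 * N Q = - log 2 \<gamma> * l Q" using k T by (simp add: \<epsilon>2_def N_def m_def)
      then have "2 powr (\<epsilon>2 * N Q) = (2 powr (- log 2 \<gamma>)) powr l Q" by (simp add: powr_powr)
      also have "2 powr (- log 2 \<gamma>) = inverse \<gamma>" using \<gamma> by (simp add: powr_minus)
      finally show ?thesis using \<gamma> by (simp add: powr_realpow)
    qed
    have dv: "real (num_divisors z) \<le> D" if z: "0 < z" "z < 2 ^ (T * m Q + 1)" for z
    proof -
      have "real z \<le> real (2 ^ (N Q + 1))" unfolding N_def using z(2) by (intro of_nat_mono less_imp_le)
      then have "real z \<le> 2 ^ (N Q + 1)" by simp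
      then have "real z powr \<epsilon>2 \<le> (2 ^ (N Q + 1)) powr \<epsilon>2" using z \<epsilon>2 by (intro powr_mono2) auto
      also have "\<dots> = 2 powr (\<epsilon>2 * N Q) * 2 powr \<epsilon>2"
      proof -
        have "(2::real) ^ (N Q + 1) = 2 powr real (N Q + 1)" by (rule powr_realpow[symmetric]) simp
        then have "(2 ^ (N Q + 1)) powr \<epsilon>2 = 2 powr (real (N Q + 1) * \<epsilon>2)" by (simp only: powr_powr)
        also have "real (N Q + 1) * \<epsilon>2 = \<epsilon>2 * N Q + \<epsilon>2" by (simp add: algebra_simps)
        finally show ?thesis by (simp only: powr_add)
      qed
      finally have "C * real z powr \<epsilon>2 \<le> C * (2 powr (\<epsilon>2 * N Q) * 2 powr \<epsilon>2)" using C by (intro mult_left_mono) auto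
      then show ?thesis using C(2)[OF z(1)] by (simp add: D_def C2_def pow2 mult_ac)
    qed
    have Qs: "real Q * (2 ^ T * exp (- h * m Q) ^ (T - 1)) \<le> C1"
    proof -
      have L: "0 \<le> log 2 Q" using Q by simp
      have "ln 2 * T * log 2 Q \<le> (real T - 1) * (h * \<theta>) * log 2 Q"
        using T L by (intro mult_right_mono) auto
      also have "\<dots> = h * (real T - 1) * (\<theta> * log 2 Q)" by simp
      also have "\<dots> \<le> h * (real T - 1) * (real (N Q) + k * T)"
        using N(2)[OF Q] h0 T(1) by (intro mult_left_mono) (auto simp: T_def)
      also have "\<dots> = T * (h * (real T - 1) * (m Q + k))" by (simp add: N_def algebra_simps)
      finally have "T * (ln 2 * log 2 Q) \<le> T * (h * (real T - 1) * (m Q + k))" by (simp add: mult_ac)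
      then have "ln 2 * log 2 Q \<le> h * (real T - 1) * (m Q + k)" using T(1) by simp
      moreover have "ln 2 * log 2 Q = ln Q" by (simp add: log_def)
      ultimately have le: "ln Q \<le> h * (real T - 1) * (m Q + k)" by simp
      have T1: "real (T - 1) = real T - 1" by (simp add: T_def)
      have "real Q = exp (ln Q)" using Q by simp
      also have "\<dots> \<le> exp (h * (real T - 1) * (m Q + k))" using le by simp
      finally have "real Q * exp (- h * m Q) ^ (T - 1) \<le> exp (h * (real T - 1) * (m Q + k)) * exp (- h * m Q) ^ (T - 1)"
        by (intro mult_right_mono) auto
      also have "\<dots> = exp (h * k * (T - 1))"
        unfolding exp_of_nat_mult[symmetric] exp_add[symmetric] T1 by (simp add: algebra_simps)
      finally have "2 ^ T * (real Q * exp (- h * m Q) ^ (T - 1)) \<le> 2 ^ T * exp (h * k * (T - 1))"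
        by (intro mult_left_mono) auto
      then show ?thesis by (simp add: C1_def mult_ac)
    qed
    have gain: "((1 / 3) powr (\<epsilon> * m Q) + \<beta> ^ l Q)\<^sup>2 \<le> 4 * (\<gamma> ^ l Q)\<^sup>2"
    proof -
      have "(1 / 3 :: real) powr (\<epsilon> * m Q) = ((1 / 3) powr (\<epsilon> * k)) ^ l Q"
        by (simp add: m_def powr_powr mult_ac powr_realpow[symmetric] del: powr_realpow)
      also have "\<dots> \<le> \<gamma> ^ l Q" using \<gamma> by (intro power_mono) auto
      finally have "(1 / 3) powr (\<epsilon> * m Q) + \<beta> ^ l Q \<le> 2 * \<gamma> ^ l Q"
        using power_mono[OF \<gamma>(3), of "l Q"] \<beta> by simp
      then have "((1 / 3) powr (\<epsilon> * m Q) + \<beta> ^ l Q)\<^sup>2 \<le> (2 * \<gamma> ^ l Q)\<^sup>2" using \<beta> by (intro power_mono) auto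
      then show ?thesis by (simp add: power_mult_distrib)
    qed
    have "(\<Sum>q\<in>G Q. S Q q) \<le> ((1 / 3) powr (\<epsilon> * m Q) + \<beta> ^ l Q)\<^sup>2
        * (T * (real Q * (real Q * (2 ^ T * exp (- h * m Q) ^ (T - 1)) + D)))"
      unfolding S_def \<rho>_def N_def
      by (rule sum_fourier_generic_le[OF T(1) loss dv GQ]) (auto simp: G_def N_def)
    also have "\<dots> \<le> (4 * (\<gamma> ^ l Q)\<^sup>2) * (T * (real Q * (C1 + D)))"
      using gain Qs C2 \<gamma> by (intro mult_mono mult_left_mono add_right_mono) (auto simp: D_def C1_def intro!: add_nonneg_nonneg mult_nonneg_nonneg)
    also have "\<dots> = 4 * T * real Q * \<gamma> ^ l Q * (C1 * \<gamma> ^ l Q + C2)"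
      using \<gamma> by (simp add: D_def power2_eq_square field_simps power_inverse)
    also have "\<dots> \<le> 4 * T * real Q * \<gamma> ^ l Q * (C1 * 1 + C2)"
      using \<gamma> by (intro mult_left_mono add_right_mono power_le_one) (auto simp: C1_def)
    also have "\<dots> = E * \<gamma> ^ l Q * Q" by (simp add: E_def algebra_simps)
    finally show ?thesis .
  qed
  have L_top: "filterlim (\<lambda>Q. log 2 (real Q)) at_top sequentially"
    by (rule filterlim_compose[OF _ filterlim_real_sequentially]) real_asymp
  have l_top: "filterlim l at_top sequentially"
    unfolding filterlim_at_top
  proof
    fix Z :: nat
    have "\<forall>\<^sub>F Q in sequentially. Z * (k * T) / \<theta> \<le> log 2 (real Q)"
      using L_top by (simp add: filterlim_at_top)
    then show "\<forall>\<^sub>F Q in sequentially. Z \<le> l Q"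
    proof eventually_elim
      case (elim Q)
      then have "real Z \<le> \<theta> * log 2 (real Q) / (k * T)" using \<theta> k T by (simp add: field_simps)
      then show ?case unfolding l_def by (simp add: le_nat_floor)
    qed
  qed
  have g0: "(\<lambda>Q. \<gamma> ^ l Q) \<longlonglongrightarrow> 0"
    using \<gamma> by (intro filterlim_compose[OF LIMSEQ_power_zero l_top]) simp
  have ev: "\<forall>\<^sub>F Q in sequentially. 2 * T * \<gamma> ^ l Q < \<eta> / 2"
    by (rule order_tendstoD(2)[OF tendsto_mult_left[OF g0]]) (use \<eta> in simp)
  have ev2: "\<forall>\<^sub>F Q in sequentially. E * \<gamma> ^ l Q < \<eta>' / 4 * (\<eta>\<^sup>2 / 4)"
    by (rule order_tendstoD(2)[OF tendsto_mult_left[OF g0]]) (use \<eta> \<eta>' in simp)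
  have ev3: "\<forall>\<^sub>F Q in sequentially. k * T / (\<theta> - (1 + \<kappa>)) \<le> log 2 (real Q)"
    "\<forall>\<^sub>F Q in sequentially. - (c + \<delta>) * log 2 (\<eta>' / 4) / (\<delta> / 2) \<le> log 2 (real Q)"
    using L_top by (simp_all add: filterlim_at_top)
  show ?thesis
    using ev ev2 ev3 eventually_ge_at_top[of 1]
  proof eventually_elim
    case (elim Q)
    have NQ: "(1 + \<kappa>) * log 2 Q \<le> N Q"
    proof -
      have "k * T \<le> (\<theta> - (1 + \<kappa>)) * log 2 Q" using elim(3) \<kappa> by (simp add: field_simps)
      then show ?thesis using N(2)[OF elim(5)] by (simp add: algebra_simps)
    qed
    let ?X = "{q::nat. odd q \<and> q \<le> Q \<and> (\<exists>n::nat. real n \<ge> (c + \<delta>) * log 2 (real q) \<and> walk_dist 2 steps q n > \<eta>)}"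
    let ?A = "{1..nat \<lfloor>\<eta>' / 4 * Q\<rfloor>}"
    let ?B = "{q. odd q \<and> q \<le> Q \<and> (\<exists>x. 0 < x \<and> x < q \<and> real (flips (N Q) x q) < \<epsilon> * N Q)}"
    let ?C = "{q \<in> G Q. \<eta>\<^sup>2 / 4 < S Q q}"
    have "?X \<subseteq> ?A \<union> ?B \<union> ?C"
    proof
      fix q assume "q \<in> ?X"
      then obtain n :: nat where q: "odd q" "q \<le> Q" and n: "(c + \<delta>) * log 2 (real q) \<le> n" "\<eta> < walk_dist 2 steps q n"
        by auto
      have q0: "0 < q" using q by (auto elim: oddE)
      show "q \<in> ?A \<union> ?B \<union> ?C"
      proof (rule ccontr)
        assume not: "q \<notin> ?A \<union> ?B \<union> ?C"
        then have "q \<notin> ?A" by blast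
        then have "nat \<lfloor>\<eta>' / 4 * Q\<rfloor> < q" using q0 by (simp only: atLeastAtMost_iff) linarith
        then have "\<eta>' / 4 * Q < q" by linarith
        moreover have "0 < \<eta>' / 4 * Q" using \<eta>' elim(5) by simp
        ultimately have "log 2 (\<eta>' / 4 * Q) \<le> log 2 q" using q0 by (subst log_le_cancel_iff) linarith+
        moreover have "log 2 (\<eta>' / 4 * Q) = log 2 (\<eta>' / 4) + log 2 Q"
          by (rule log_mult_pos) (use \<eta>' elim(5) in auto)
        ultimately have "log 2 (\<eta>' / 4) + log 2 Q \<le> log 2 q" by simp
        then have "(c + \<delta>) * (log 2 (\<eta>' / 4) + log 2 Q) \<le> (c + \<delta>) * log 2 q"
          using c \<delta> by (intro mult_left_mono) auto
        moreover have "- (c + \<delta>) * log 2 (\<eta>' / 4) \<le> \<delta> / 2 * log 2 Q" using elim(4) \<delta> by (simp add: field_simps)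
        ultimately have "\<theta> * log 2 Q \<le> n" using n(1) by (simp add: \<theta>_def algebra_simps)
        then have "N Q \<le> n" using N(1)[OF elim(5)] by linarith
        then have "\<eta> < walk_dist 2 steps q (N Q)" using n(2) walk_dist_antimono[OF q(1), of "N Q" n] by linarith
        also have "\<dots> \<le> 2 * (1 - (\<Sum>x\<in>window (N Q). \<rho> Q x)) + sqrt (S Q q)"
          unfolding S_def
          by (rule walk_dist_le_fourier[OF q0]) (auto simp: \<rho>_def N_def trunc_bounds intro: chain_le_law)
        also have "1 - T * \<beta> ^ l Q \<le> (\<Sum>x\<in>window (N Q). \<rho> Q x)"
          unfolding \<rho>_def N_def using \<beta> by (intro sum_chain_trunc_ge loss power_le_one) auto
        then have "2 * (1 - (\<Sum>x\<in>window (N Q). \<rho> Q x)) \<le> 2 * T * \<beta> ^ l Q" by simp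
        also have "\<dots> \<le> 2 * T * \<gamma> ^ l Q" using \<gamma> \<beta> by (intro mult_left_mono power_mono) auto
        also have "\<dots> < \<eta> / 2" by (rule elim(1))
        finally have "\<eta> / 2 < sqrt (S Q q)" by linarith
        then have "(\<eta> / 2)\<^sup>2 < S Q q" using \<eta> real_sqrt_less_iff[of "(\<eta> / 2)\<^sup>2" "S Q q"] by simp
        then have "\<eta>\<^sup>2 / 4 < S Q q" by (simp add: power_divide)
        moreover have "q \<in> G Q"
        proof -
          have "\<not> real (flips (N Q) x q) < \<epsilon> * N Q" if "0 < x" "x < q" for x
            using not q that by blast
          then show ?thesis using q unfolding G_def not_less by blast
        qed
        ultimately have "q \<in> ?C" by blast
        then show False using not by blast
      qed
    qed
    then have "card ?X \<le> card (?A \<union> ?B \<union> ?C)"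
      using finite_subset[OF GQ[of Q]] by (intro card_mono) (auto intro: finite_subset[of _ "{..Q}"])
    also have "\<dots> \<le> card ?A + card ?B + card ?C"
      by (meson add_right_mono card_Un_le order_trans)
    finally have "real (card ?X) \<le> real (card ?A) + real (card ?B) + real (card ?C)" by linarith
    moreover have "real (card ?A) \<le> \<eta>' / 4 * Q"
      unfolding card_atLeastAtMost diff_Suc_1 by (rule of_nat_floor) (use \<eta>' in simp)
    moreover have "real (card ?B) \<le> \<eta>' / 4 * Q" by (rule rare[OF NQ])
    moreover have "real (card ?C) \<le> \<eta>' / 4 * Q"
    proof -
      have "finite (G Q)" using GQ by (rule finite_subset) simp
      have "real (card ?C) * (\<eta>\<^sup>2 / 4) = (\<Sum>q\<in>?C. \<eta>\<^sup>2 / 4)" by simp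
      also have "\<dots> \<le> (\<Sum>q\<in>?C. S Q q)" by (intro sum_mono) simp
      also have "\<dots> \<le> (\<Sum>q\<in>G Q. S Q q)"
        using \<open>finite (G Q)\<close> by (intro sum_mono2) (auto simp: S_def intro!: sum_nonneg)
      also have "\<dots> \<le> E * \<gamma> ^ l Q * Q" by (rule main[OF elim(5)])
      also have "\<dots> \<le> \<eta>' / 4 * (\<eta>\<^sup>2 / 4) * Q" using elim(2) by (intro mult_right_mono) auto
      also have "\<dots> = \<eta>' / 4 * Q * (\<eta>\<^sup>2 / 4)" by simp
      finally show ?thesis using \<eta> by (subst (asm) mult_le_cancel_right_pos) auto
    qed
    moreover have "0 \<le> \<eta>' * real Q" using \<eta>' by simp
    ultimately show ?case by linarith
  qed
qed

theorem mainTheorem3: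
  fixes \<mu> :: "int pmf" and a :: int and c :: real
  assumes mu: "\<mu> = pmf_of_set {-1, 0, 1}"
    and a: "a = 2"
    and c: "c = ln 2 / asymptotic_entropy a \<mu>"
    and known_value:
      "0.9887658714 \<le> asymptotic_entropy a \<mu> / ln 2"
      "asymptotic_entropy a \<mu> / ln 2 < 0.9887658715"
  shows "1.01136 \<le> c \<and> c < 1.01137 \<and>
    (\<forall>\<delta>>0. \<forall>\<eta>>0.
      (\<forall>\<^sub>F q in sequentially. \<forall>n::nat.
         real n \<le> (c - \<delta>) * log 2 (real q) \<longrightarrow> 1 / 2 * walk_dist a \<mu> q n \<ge> 1 - \<eta>) \<and>
      (\<lambda>Q::nat. real (card {q::nat. odd q \<and> q \<le> Q \<and>
          (\<exists>n::nat. real n \<ge> (c + \<delta>) * log 2 (real q) \<and> walk_dist a \<mu> q n > \<eta>)}))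
        \<in> o(\<lambda>Q. real Q))"
proof -
  define H where "H = asymptotic_entropy 2 steps"
  have cH: "c = ln 2 / H" using c a mu by (simp add: H_def)
  have ln2: "0 < ln (2::real)" by simp
  have "0.9887658714 \<le> H / ln 2" "H / ln 2 < 0.9887658715"
    using known_value a mu by (simp_all add: H_def)
  then have H: "0.9887658714 * ln 2 \<le> H" "H < 0.9887658715 * ln 2"
    using ln2 by (simp_all add: pos_le_divide_eq pos_divide_less_eq)
  then have H0: "0 < H" using ln2 by linarith
  have c_bounds: "1.01136 \<le> c" "c < 1.01137"
  proof -
    have "1.01136 * H \<le> 1.01136 * (0.9887658715 * ln 2)" using H by (intro mult_left_mono) auto
    also have "\<dots> \<le> ln 2" using ln2 by simp
    finally have "1.01136 * H \<le> ln 2" .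
    moreover have "ln 2 < 1.01137 * H"
    proof -
      have "ln 2 < 1.01137 * (0.9887658714 * ln (2::real))" using ln2 by simp
      also have "\<dots> \<le> 1.01137 * H" using H by (intro mult_left_mono) auto
      finally show ?thesis .
    qed
    ultimately show "1.01136 \<le> c" "c < 1.01137" using H0 by (simp_all add: cH pos_le_divide_eq pos_divide_less_eq)
  qed
  have "(1 :: real) < 1.01136" by simp
  then have c1: "1 < c" using c_bounds(1) by (rule less_le_trans)
  show ?thesis
  proof (intro conjI allI impI c_bounds)
    fix \<delta> \<eta> :: real assume \<delta>: "0 < \<delta>" and \<eta>: "0 < \<eta>"
    have "(c - \<delta>) * H < ln 2" using H0 \<delta> by (simp add: cH left_diff_distrib)
    then show "\<forall>\<^sub>F q in sequentially. \<forall>n::nat.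
         real n \<le> (c - \<delta>) * log 2 (real q) \<longrightarrow> 1 / 2 * walk_dist a \<mu> q n \<ge> 1 - \<eta>"
      unfolding a mu using not_mixed_early[of "c - \<delta>" \<eta>] H0 \<eta> by (simp only: H_def)
    let ?X = "\<lambda>Q. {q::nat. odd q \<and> q \<le> Q \<and>
          (\<exists>n::nat. real n \<ge> (c + \<delta>) * log 2 (real q) \<and> walk_dist a \<mu> q n > \<eta>)}"
    show "(\<lambda>Q::nat. real (card (?X Q))) \<in> o(\<lambda>Q. real Q)"
    proof (rule landau_o.smallI)
      fix \<eta>' :: real assume \<eta>': "0 < \<eta>'"
      have "\<forall>\<^sub>F Q in sequentially. real (card (?X Q)) \<le> \<eta>' * real Q"
        unfolding a mu
        using H0 cH c1 \<delta> \<eta> \<eta>' unfolding H_def by (rule mixed_late)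
      then show "\<forall>\<^sub>F Q in sequentially. norm (real (card (?X Q))) \<le> \<eta>' * norm (real Q)"
        by simp
    qed
  qed
qed

end
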